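(* Let $V$ be an $m$-dimensional vector space over a division ring and let $i$ be an integer with $1<i<m-1$. Let $\Pi$ be a polar space of rank $n$ and let $k\in\{0,1,\dots,n-1\}$. If $f$ is an embedding of the Grassmann graph $\Gamma_i(V)$ in the polar Grassmann graph $\Gamma_k(\Pi)$, then $k\le n-3$ and one of the following holds: (A) $k\ge 1$ and there is a singular subspace $U$ of $\Pi$ such that the image of $f$ is contained in $\langle U]_k$; (B) there is a $(k-1)$-dimensional singular subspace $S$ of $\Pi$ such that the image of $f$ is contained in $[S\rangle_k$.
   Context: A partial linear space is a pair $(P,\mathcal L)$ of a set of points and a family of proper subsets (lines), each line having at least two points, each point on some line, and two distinct points on at most one common line; points on a common line are collinear, written $p\perp q$, and for sets $X\perp Y$ means every point of $X$ is collinear with every point of $Y$. A subspace is a set of points containing the line through any two of its collinear points; it is singular if any two of its points are collinear. A polar space is a partial linear space in which every line has at least three points, no point is collinear with all points, every point is collinear with one or all points of any line, and every chain of distinct incident singular subspaces is finite. Singular subspaces are projective spaces and "dimension" means projective dimension (points have dimension 0, the empty set has dimension $-1$); the polar space has rank $n$ if maximal singular subspaces have dimension $n-1$. $\mathcal G_k(\Pi)$ denotes the set of $k$-dimensional singular subspaces. The polar Grassmann graph $\Gamma_k(\Pi)$ has vertex set $\mathcal G_k(\Pi)$; for $k\le n-2$ two distinct vertices are adjacent if some $(k+1)$-dimensional singular subspace contains both; for $k=n-1$ two distinct vertices are adjacent if their intersection is $(n-2)$-dimensional. For a singular subspace $U$, $\langle U]_k$ is the set of elements of $\mathcal G_k(\Pi)$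 contained in $U$; for a singular subspace $S$ of dimension $<k$, $[S\rangle_k$ is the set of elements of $\mathcal G_k(\Pi)$ containing $S$. The Grassmann graph $\Gamma_i(V)$ has as vertices the $i$-dimensional subspaces of $V$, two being adjacent iff their intersection is $(i-1)$-dimensional. An embedding of a graph $\Gamma$ in a graph $\Gamma'$ is an injection of vertex sets sending adjacent vertices to adjacent vertices and non-adjacent vertices to non-adjacent vertices. *)

theory Defs
  imports Main
begin

section \<open>Vector spaces over division rings and Grassmann graphs\<close>

text \<open>
  The library's \<open>module\<close> and \<open>vector_space\<close> require commutative scalars, so left vector spaces
  over an arbitrary (possibly non-commutative) division ring are set up here.
\<close>

locale left_vector_space =
  fixes scale :: "'d::division_ring \<Rightarrow> 'v::ab_group_add \<Rightarrow> 'v"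
  assumes scale_right_distrib: "scale a (x + y) = scale a x + scale a y"
    and scale_left_distrib: "scale (a + b) x = scale a x + scale b x"
    and scale_scale: "scale a (scale b x) = scale (a * b) x"
    and scale_one: "scale 1 x = x"

definition lin_subspace :: "('d::division_ring \<Rightarrow> 'v::ab_group_add \<Rightarrow> 'v) \<Rightarrow> 'v set \<Rightarrow> bool" where
  "lin_subspace scale W \<longleftrightarrow>
     0 \<in> W \<and> (\<forall>x\<in>W. \<forall>y\<in>W. x + y \<in> W) \<and> (\<forall>a. \<forall>x\<in>W. scale a x \<in> W)"

definition finite_basis ::
    "('d::division_ring \<Rightarrow> 'v::ab_group_add \<Rightarrow> 'v) \<Rightarrow> 'v set \<Rightarrow> 'v set \<Rightarrow> bool" where
  "finite_basis scale W B \<longleftrightarrow>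
     finite B \<and> B \<subseteq> W \<and>
     (\<forall>c. (\<Sum>b\<in>B. scale (c b) b) = 0 \<longrightarrow> (\<forall>b\<in>B. c b = 0)) \<and>
     (\<forall>w\<in>W. \<exists>c. w = (\<Sum>b\<in>B. scale (c b) b))"

definition has_lin_dim ::
    "('d::division_ring \<Rightarrow> 'v::ab_group_add \<Rightarrow> 'v) \<Rightarrow> 'v set \<Rightarrow> nat \<Rightarrow> bool" where
  "has_lin_dim scale W d \<longleftrightarrow> lin_subspace scale W \<and> (\<exists>B. finite_basis scale W B \<and> card B = d)"

definition grassmannian ::
    "('d::division_ring \<Rightarrow> 'v::ab_group_add \<Rightarrow> 'v) \<Rightarrow> nat \<Rightarrow> 'v set set" where
  "grassmannian scale i = {W. has_lin_dim scale W i}"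

definition grassmann_adj ::
    "('d::division_ring \<Rightarrow> 'v::ab_group_add \<Rightarrow> 'v) \<Rightarrow> nat \<Rightarrow> 'v set \<Rightarrow> 'v set \<Rightarrow> bool" where
  "grassmann_adj scale i X Y \<longleftrightarrow>
     X \<in> grassmannian scale i \<and> Y \<in> grassmannian scale i \<and> has_lin_dim scale (X \<inter> Y) (i - 1)"


section \<open>Partial linear spaces and polar spaces\<close>

text \<open>\<open>P\<close> is the set of points and \<open>L\<close> the family of lines, given as sets of points.\<close>

definition partial_linear_space :: "'p set \<Rightarrow> 'p set set \<Rightarrow> bool" where
  "partial_linear_space P L \<longleftrightarrow>
     (\<forall>l\<in>L. l \<subset> P) \<and>
     (\<forall>l\<in>L. \<exists>p\<in>l. \<exists>q\<in>l. p \<noteq> q) \<and>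
     (\<forall>p\<in>P. \<exists>l\<in>L. p \<in> l) \<and>
     (\<forall>p\<in>P. \<forall>q\<in>P. p \<noteq> q \<longrightarrow>
        (\<forall>l\<in>L. \<forall>l'\<in>L. p \<in> l \<and> q \<in> l \<and> p \<in> l' \<and> q \<in> l' \<longrightarrow> l = l'))"

definition collinear_points :: "'p set set \<Rightarrow> 'p \<Rightarrow> 'p \<Rightarrow> bool" where
  "collinear_points L p q \<longleftrightarrow> (\<exists>l\<in>L. p \<in> l \<and> q \<in> l)"

definition point_subspace :: "'p set \<Rightarrow> 'p set set \<Rightarrow> 'p set \<Rightarrow> bool" where
  "point_subspace P L S \<longleftrightarrow>
     S \<subseteq> P \<and> (\<forall>p\<in>S. \<forall>q\<in>S. p \<noteq> q \<longrightarrow> (\<forall>l\<in>L. p \<in> l \<and> q \<in> l \<longrightarrow> l \<subseteq> S))"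

definition singular_subspace :: "'p set \<Rightarrow> 'p set set \<Rightarrow> 'p set \<Rightarrow> bool" where
  "singular_subspace P L S \<longleftrightarrow>
     point_subspace P L S \<and> (\<forall>p\<in>S. \<forall>q\<in>S. collinear_points L p q)"

definition polar_space :: "'p set \<Rightarrow> 'p set set \<Rightarrow> bool" where
  "polar_space P L \<longleftrightarrow>
     partial_linear_space P L \<and>
     (\<forall>l\<in>L. \<exists>p\<in>l. \<exists>q\<in>l. \<exists>r\<in>l. p \<noteq> q \<and> p \<noteq> r \<and> q \<noteq> r) \<and>
     (\<forall>p\<in>P. \<not> (\<forall>q\<in>P. collinear_points L p q)) \<and>
     (\<forall>p\<in>P. \<forall>l\<in>L. (\<exists>!q. q \<in> l \<and> collinear_points L p q) \<or> (\<forall>q\<in>l. collinear_points L p q)) \<and>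
     (\<forall>C. subset.chain {S. singular_subspace P L S} C \<longrightarrow> finite C)"

definition point_span :: "'p set \<Rightarrow> 'p set set \<Rightarrow> 'p set \<Rightarrow> 'p set" where
  "point_span P L X = \<Inter> {T. point_subspace P L T \<and> X \<subseteq> T}"

definition independent_points :: "'p set \<Rightarrow> 'p set set \<Rightarrow> 'p set \<Rightarrow> bool" where
  "independent_points P L B \<longleftrightarrow> (\<forall>Y. Y \<subset> B \<longrightarrow> point_span P L Y \<noteq> point_span P L B)"

text \<open>
  Projective dimension: one less than the size of an independent generating set, hence an integer
  (the empty subspace has dimension \<open>-1\<close>).
\<close>

definition has_proj_dim :: "'p set \<Rightarrow> 'p set set \<Rightarrow> 'p set \<Rightarrow> int \<Rightarrow> bool" where
  "has_proj_dim P L S d \<longleftrightarrow>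
     (\<exists>B. finite B \<and> B \<subseteq> S \<and> independent_points P L B \<and> point_span P L B = S \<and>
          int (card B) - 1 = d)"

definition maximal_singular :: "'p set \<Rightarrow> 'p set set \<Rightarrow> 'p set \<Rightarrow> bool" where
  "maximal_singular P L M \<longleftrightarrow>
     singular_subspace P L M \<and> (\<forall>S. singular_subspace P L S \<and> M \<subseteq> S \<longrightarrow> S = M)"

definition has_rank :: "'p set \<Rightarrow> 'p set set \<Rightarrow> nat \<Rightarrow> bool" where
  "has_rank P L n \<longleftrightarrow> (\<forall>M. maximal_singular P L M \<longrightarrow> has_proj_dim P L M (int n - 1))"

definition polar_grassmannian :: "'p set \<Rightarrow> 'p set set \<Rightarrow> int \<Rightarrow> 'p set set" where
  "polar_grassmannian P L k = {S. singular_subspace P L S \<and> has_proj_dim P L S k}"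

text \<open>The parameter \<open>n\<close> is meant to be the rank of the polar space.\<close>

definition polar_grassmann_adj ::
    "'p set \<Rightarrow> 'p set set \<Rightarrow> nat \<Rightarrow> int \<Rightarrow> 'p set \<Rightarrow> 'p set \<Rightarrow> bool" where
  "polar_grassmann_adj P L n k X Y \<longleftrightarrow>
     X \<in> polar_grassmannian P L k \<and> Y \<in> polar_grassmannian P L k \<and> X \<noteq> Y \<and>
     ((k \<le> int n - 2 \<and> (\<exists>Z\<in>polar_grassmannian P L (k + 1). X \<subseteq> Z \<and> Y \<subseteq> Z)) \<or>
      (k = int n - 1 \<and> has_proj_dim P L (X \<inter> Y) (int n - 2)))"

definition elements_below :: "'p set \<Rightarrow> 'p set set \<Rightarrow> int \<Rightarrow> 'p set \<Rightarrow> 'p set set" where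
  "elements_below P L k U = {X \<in> polar_grassmannian P L k. X \<subseteq> U}"

definition elements_above :: "'p set \<Rightarrow> 'p set set \<Rightarrow> int \<Rightarrow> 'p set \<Rightarrow> 'p set set" where
  "elements_above P L k S = {X \<in> polar_grassmannian P L k. S \<subseteq> X}"


section \<open>Graph embeddings\<close>

definition graph_embedding ::
    "'a set \<Rightarrow> ('a \<Rightarrow> 'a \<Rightarrow> bool) \<Rightarrow> 'b set \<Rightarrow> ('b \<Rightarrow> 'b \<Rightarrow> bool) \<Rightarrow> ('a \<Rightarrow> 'b) \<Rightarrow> bool" where
  "graph_embedding V adj V' adj' f \<longleftrightarrow>
     f ` V \<subseteq> V' \<and> inj_on f V \<and> (\<forall>x\<in>V. \<forall>y\<in>V. adj x y \<longleftrightarrow> adj' (f x) (f y))"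

end

theory Submission imports Defs begin

text \<open>
  A clique of \<open>\<Gamma>\<^sub>k(\<Pi>)\<close> has a common \<open>(k-1)\<close>-dimensional subspace (star type) or lies in a
  \<open>(k+1)\<close>-dimensional one (top type). The images of a star and a top of \<open>\<Gamma>\<^sub>i(V)\<close> that share an edge
  cannot both be of top type, since their union is not a clique. Two stars through a common vertex are
  linked by tops that meet each of them in an edge; if one star has star type and the other has not,
  these tops all have star type and carry the \<open>(k-1)\<close>-dimensional subspace of the first star to the
  second, a contradiction. So all stars have star type or all have top type, and dually for tops. If
  both classes have star type, the common \<open>(k-1)\<close>-dimensional subspace is the same everywhere. If the
  stars (say) have top type, any two images are collinear, by induction on the distance: \<open>Y\<close> lies in
  a star with two vertices \<open>Y1\<close>, \<open>Y2\<close> closer to \<open>X\<close>, and \<open>f Y\<close> is contained in the span of \<open>f Y1\<close> and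
  \<open>f Y2\<close>. For \<open>k \<ge> n - 2\<close> every edge of \<open>\<Gamma>\<^sub>k(\<Pi>)\<close> lies in a unique maximal clique, unlike in
  \<open>\<Gamma>\<^sub>i(V)\<close>.

  The dimension theory needs that singular subspaces are projective spaces. This follows from the fact
  that \<open>{a, b}\<^sup>\<bottom>\<^sup>\<bottom>\<close> is the line \<open>ab\<close> for distinct collinear points, applied in the polar space
  \<open>{p, x}\<^sup>\<bottom>\<close> with \<open>x\<close> collinear with a given line but not with the point \<open>p\<close> off that line.
\<close>

section \<open>Perps in polar spaces\<close>

text \<open>Reflexive also at points on no line, which may occur in \<open>hyperbolic_perp\<close> below.\<close>

definition perp :: "'p set set \<Rightarrow> 'p \<Rightarrow> 'p \<Rightarrow> bool" where
  "perp L p q \<longleftrightarrow> p = q \<or> collinear_points L p q"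

lemma perp_refl [simp]: "perp L p p"
  by (simp add: perp_def)

lemma perp_sym: "perp L p q \<Longrightarrow> perp L q p"
  by (auto simp: perp_def collinear_points_def)

lemma perp_line: "l \<in> L \<Longrightarrow> p \<in> l \<Longrightarrow> q \<in> l \<Longrightarrow> perp L p q"
  by (auto simp: perp_def collinear_points_def)

lemma perp_lineE:
  assumes "perp L p q" "p \<noteq> q"
  obtains l where "l \<in> L" "p \<in> l" "q \<in> l"
  using assms by (auto simp: perp_def collinear_points_def)

text \<open>The axioms are chosen to pass to the residues \<open>hyperbolic_perp\<close>, where a
  point may lie on no line; hence \<open>perp\<close> in place of collinearity. The one-or-all axiom
  is split into \<open>perp_some\<close> (at least one) and \<open>perp_all\<close> (two give
  all).\<close>

locale weak_polar =
  fixes P :: "'p set" and L :: "'p set set"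
  assumes line_sub: "l \<in> L \<Longrightarrow> l \<subseteq> P"
    and line_unique: "\<lbrakk>l \<in> L; l' \<in> L; p \<noteq> q; p \<in> l; q \<in> l; p \<in> l'; q \<in> l'\<rbrakk> \<Longrightarrow> l = l'"
    and perp_some: "\<lbrakk>p \<in> P; l \<in> L\<rbrakk> \<Longrightarrow> \<exists>q\<in>l. perp L p q"
    and perp_all: "\<lbrakk>p \<in> P; l \<in> L; q \<in> l; r \<in> l; q \<noteq> r; perp L p q; perp L p r; s \<in> l\<rbrakk> \<Longrightarrow> perp L p s"
    and nondegenerate: "p \<in> P \<Longrightarrow> \<exists>q\<in>P. \<not> perp L p q"
begin

text \<open>For \<open>y\<close> collinear with \<open>r\<close>, some point \<open>u\<close> of the
  line \<open>ry\<close> is collinear with \<open>p\<close>, hence with \<open>q\<close>, and so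
  with \<open>s\<close> on \<open>l\<close>. Being collinear with \<open>r\<close> and
  \<open>u\<close>, the point \<open>s\<close> is collinear with \<open>y\<close>. The inclusion of
  perps thus passes from the pair \<open>p\<close>, \<open>q\<close> to the pair \<open>r\<close>,
  \<open>s\<close>.\<close>

lemma perp_subset_transfer:
  assumes P: "p \<in> P" "q \<in> P" "r \<in> P"
    and sub: "\<And>y. y \<in> P \<Longrightarrow> perp L p y \<Longrightarrow> perp L q y"
    and l: "l \<in> L" "p \<in> l" "q \<in> l" "s \<in> l" "p \<noteq> q"
    and r: "\<not> perp L q r" "perp L r s" and y: "y \<in> P" "perp L r y"
  shows "perp L s y"
proof (cases "y = r")
  case True
  then show ?thesis using r(2) perp_sym by metis
next
  case False
  then obtain h where h: "h \<in> L" "r \<in> h" "y \<in> h"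
    using y(2) perp_lineE by metis
  obtain u where u: "u \<in> h" "perp L p u"
    using perp_some[OF P(1) h(1)] by blast
  have uP: "u \<in> P" using u h line_sub by blast
  have qu: "perp L q u" by (rule sub[OF uP u(2)])
  have "u \<noteq> r" using qu r(1) by blast
  have "perp L u s"
    by (rule perp_all[OF uP l(1-3) l(5) _ _ l(4)]) (use u qu perp_sym in metis)+
  moreover have "s \<in> P" using l line_sub by blast
  ultimately show ?thesis
    using perp_all[of s h u r y] h u \<open>u \<noteq> r\<close> r(2) perp_sym by metis
qed

text \<open>If \<open>p \<noteq> q\<close>, the inclusion is transferred twice: to \<open>r\<close>,
  \<open>s\<close> with \<open>s\<close> on the line \<open>pq\<close>, then to \<open>w\<close>,
  \<open>s'\<close> with \<open>s'\<close> on the line \<open>rs\<close>. A point \<open>t\<close>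
  of \<open>pq\<close> collinear with \<open>w\<close> is then collinear with \<open>s'\<close> and
  \<open>s\<close>, hence with \<open>r\<close>. So \<open>r\<close> is collinear with two points of
  \<open>pq\<close> and therefore with \<open>q\<close>, against its choice.\<close>

lemma perp_subset_eq:
  assumes P: "p \<in> P" "q \<in> P"
    and sub: "\<And>y. y \<in> P \<Longrightarrow> perp L p y \<Longrightarrow> perp L q y"
  shows "p = q"
proof (rule ccontr)
  assume ne: "p \<noteq> q"
  have "perp L q p" using sub[of p] P by simp
  then obtain l where l: "l \<in> L" "p \<in> l" "q \<in> l" using ne perp_lineE by metis
  obtain r where r: "r \<in> P" "\<not> perp L q r" using nondegenerate P by blast
  obtain s where s: "s \<in> l" "perp L r s" using perp_some r(1) l(1) by blast
  have sP: "s \<in> P" using s l line_sub by blast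
  have rs: "perp L s y" if "y \<in> P" "perp L r y" for y
    using perp_subset_transfer[OF P r(1) sub l s(1) ne r(2) s(2) that] .
  have "r \<noteq> s" using s r(2) l perp_line by metis
  obtain w where w: "w \<in> P" "\<not> perp L s w" using nondegenerate sP by blast
  obtain h where h: "h \<in> L" "r \<in> h" "s \<in> h"
    using s(2) \<open>r \<noteq> s\<close> perp_lineE by metis
  obtain s' where s': "s' \<in> h" "perp L w s'" using perp_some w(1) h(1) by blast
  have ws': "perp L s' y" if "y \<in> P" "perp L w y" for y
    using perp_subset_transfer[OF r(1) sP w(1) rs h s'(1) \<open>r \<noteq> s\<close> w(2) s'(2) that] .
  have "s' \<noteq> s" using s'(2) w(2) perp_sym by metis
  obtain t where t: "t \<in> l" "perp L w t" using perp_some w(1) l(1) by blast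
  have tP: "t \<in> P" using t l line_sub by blast
  have "t \<noteq> s" using t w(2) perp_sym by metis
  have "perp L t s'" using ws'[OF tP t(2)] perp_sym by metis
  moreover have "perp L t s" using perp_line l t s by metis
  ultimately have "perp L t r"
    using perp_all[of t h s s' r] tP h s' \<open>s' \<noteq> s\<close> by metis
  then have "perp L r q"
    using perp_all[of r l s t q] r(1) l s t \<open>t \<noteq> s\<close> perp_sym by metis
  then show False using r(2) perp_sym by metis
qed

text \<open>The points collinear with both of two non-collinear points form a model of the residue
  of either point.\<close>

definition hyperbolic_perp :: "'p \<Rightarrow> 'p \<Rightarrow> 'p set" where
  "hyperbolic_perp p x = {y \<in> P. perp L p y \<and> perp L x y}"

definition hyperbolic_lines :: "'p \<Rightarrow> 'p \<Rightarrow> 'p set set" where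
  "hyperbolic_lines p x = {l \<in> L. l \<subseteq> hyperbolic_perp p x}"

lemma hyperbolic_perp_line:
  assumes "p \<in> P" "x \<in> P" "y \<in> hyperbolic_perp p x" "z \<in> hyperbolic_perp p x" "y \<noteq> z"
    and "l \<in> L" "y \<in> l" "z \<in> l"
  shows "l \<in> hyperbolic_lines p x"
  using assms perp_all[of p l y z] perp_all[of x l y z] line_sub[of l]
  by (auto simp: hyperbolic_perp_def hyperbolic_lines_def)

lemma perp_hyperbolic:
  assumes "p \<in> P" "x \<in> P" "y \<in> hyperbolic_perp p x" "z \<in> hyperbolic_perp p x"
  shows "perp (hyperbolic_lines p x) y z \<longleftrightarrow> perp L y z"
proof
  assume "perp L y z"
  then show "perp (hyperbolic_lines p x) y z"
    using hyperbolic_perp_line[OF assms] by (auto simp: perp_def collinear_points_def)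
next
  assume "perp (hyperbolic_lines p x) y z"
  then show "perp L y z"
    by (auto simp: perp_def collinear_points_def hyperbolic_lines_def)
qed

text \<open>The line \<open>pz\<close> has a point collinear with \<open>x\<close>, and this is not
  \<open>p\<close>. So every line through \<open>p\<close> is represented by a point of
  \<open>hyperbolic_perp p x\<close>, which is how that set models the residue of
  \<open>p\<close>.\<close>

lemma hyperbolic_proj:
  assumes "p \<in> P" "x \<in> P" "\<not> perp L p x" "z \<noteq> p" "perp L p z"
  obtains l z' where "l \<in> L" "p \<in> l" "z \<in> l" "z' \<in> l" "z' \<noteq> p" "z' \<in> hyperbolic_perp p x"
proof -
  obtain l where l: "l \<in> L" "p \<in> l" "z \<in> l" using assms perp_lineE by metis
  obtain z' where z': "z' \<in> l" "perp L x z'" using perp_some assms(2) l(1) by blast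
  have "z' \<noteq> p" using z' assms(3) perp_sym by metis
  moreover have "z' \<in> hyperbolic_perp p x"
    using z' l line_sub perp_line[OF l(1,2) z'(1)] by (auto simp: hyperbolic_perp_def)
  ultimately show thesis using that l z' by blast
qed

text \<open>Only nondegeneracy takes an argument. A point \<open>t\<close> collinear with all of
  \<open>hyperbolic_perp p x\<close>, and with \<open>p\<close>, is collinear with everything
  collinear with \<open>p\<close>, by projecting along lines through \<open>p\<close>. Then
  \<open>perp_subset_eq\<close> gives \<open>t = p\<close>, although \<open>t\<close> is collinear
  with \<open>x\<close>.\<close>

lemma weak_polar_hyperbolic:
  assumes p: "p \<in> P" and x: "x \<in> P" and px: "\<not> perp L p x"
  shows "weak_polar (hyperbolic_perp p x) (hyperbolic_lines p x)"
proof
  let ?R = "hyperbolic_perp p x" and ?K = "hyperbolic_lines p x"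
  note pR = perp_hyperbolic[OF p x]
  have RP: "?R \<subseteq> P" by (auto simp: hyperbolic_perp_def)
  show KR: "l \<subseteq> ?R" if "l \<in> ?K" for l
    using that by (simp add: hyperbolic_lines_def)
  have KL: "l \<in> L" if "l \<in> ?K" for l
    using that by (simp add: hyperbolic_lines_def)
  show "l = l'" if "l \<in> ?K" "l' \<in> ?K" "a \<noteq> b" "a \<in> l" "b \<in> l" "a \<in> l'" "b \<in> l'" for l l' a b
    using line_unique KL that by metis
  show "\<exists>q\<in>l. perp ?K a q" if "a \<in> ?R" "l \<in> ?K" for a l
    using perp_some[of a l] that KL KR RP pR by blast
  show "perp ?K a s" if "a \<in> ?R" "l \<in> ?K" "q \<in> l" "r \<in> l" "q \<noteq> r" "perp ?K a q" "perp ?K a r" "s \<in> l"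
    for a l q r s
  proof -
    have "q \<in> ?R" "r \<in> ?R" "s \<in> ?R" using KR that by blast+
    then show ?thesis
      using perp_all[of a l q r s] that KL RP pR by blast
  qed
  show "\<exists>q\<in>?R. \<not> perp ?K t q" if t: "t \<in> ?R" for t
  proof (rule ccontr)
    assume "\<not> ?thesis"
    then have all: "perp L t q" if "q \<in> ?R" for q using that pR t by blast
    have tp: "perp L t p" and tP: "t \<in> P" and tx: "perp L x t"
      using t perp_sym by (auto simp: hyperbolic_perp_def)
    have "perp L t y" if y: "y \<in> P" "perp L p y" for y
    proof (cases "y = p")
      case True
      then show ?thesis using tp by simp
    next
      case False
      from hyperbolic_proj[OF p x px False y(2)] obtain l y'
        where l: "l \<in> L" "p \<in> l" "y \<in> l" "y' \<in> l" "y' \<noteq> p" "y' \<in> ?R" .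
      show ?thesis
        by (rule perp_all[OF tP l(1,4,2,5) all[OF l(6)] tp l(3)])
    qed
    then have "p = t" using perp_subset_eq[OF p tP] by blast
    then show False using tx px perp_sym by metis
  qed
qed

text \<open>The lines \<open>ab\<close> and \<open>az\<close> are projected to points
  \<open>b'\<close> and \<open>z'\<close> of the residue of \<open>a\<close>. The hypothesis
  \<open>sub\<close> becomes an inclusion of perps there, so \<open>perp_subset_eq\<close> gives
  \<open>b' = z'\<close> and the two lines coincide.\<close>

lemma line_bi_perp:
  assumes P: "a \<in> P" "b \<in> P" "z \<in> P" and l: "l \<in> L" "a \<in> l" "b \<in> l" and ab: "a \<noteq> b"
    and sub: "\<And>y. y \<in> P \<Longrightarrow> perp L a y \<Longrightarrow> perp L b y \<Longrightarrow> perp L z y"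
  shows "z \<in> l"
proof (rule ccontr)
  assume zl: "z \<notin> l"
  have "perp L a b" using l perp_line by metis
  then have az: "perp L a z" using sub[of a] P perp_sym by (metis perp_refl)
  obtain y where y: "y \<in> P" "\<not> perp L a y" using nondegenerate P by blast
  interpret R: weak_polar "hyperbolic_perp a y" "hyperbolic_lines a y"
    by (rule weak_polar_hyperbolic[OF P(1) y])
  have RP: "hyperbolic_perp a y \<subseteq> P" by (auto simp: hyperbolic_perp_def)
  from hyperbolic_proj[OF P(1) y _ \<open>perp L a b\<close>] ab obtain l' b'
    where b': "l' \<in> L" "a \<in> l'" "b \<in> l'" "b' \<in> l'" "b' \<noteq> a" "b' \<in> hyperbolic_perp a y" by metis
  have "l' = l" using line_unique b' l ab by metis
  from hyperbolic_proj[OF P(1) y _ az] zl l obtain h z'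
    where z': "h \<in> L" "a \<in> h" "z \<in> h" "z' \<in> h" "z' \<noteq> a" "z' \<in> hyperbolic_perp a y" by metis
  have "b' = z'"
  proof (rule R.perp_subset_eq[OF b'(6) z'(6)])
    fix w assume w: "w \<in> hyperbolic_perp a y" "perp (hyperbolic_lines a y) b' w"
    have wP: "w \<in> P" using w RP by blast
    have aw: "perp L a w" using w by (simp add: hyperbolic_perp_def)
    have "perp L b' w" using w perp_hyperbolic[OF P(1) y(1) b'(6)] by blast
    then have "perp L w b"
      using perp_all[of w l' a b' b] b' wP aw perp_sym by metis
    then have "perp L z w" using sub[OF wP aw] perp_sym by metis
    then have "perp L w z'"
      using perp_all[of w h a z z'] z' wP aw zl l perp_sym by metis
    then show "perp (hyperbolic_lines a y) z' w"
      using perp_hyperbolic[OF P(1) y(1) z'(6) w(1)] perp_sym by metis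
  qed
  then have "h = l" using line_unique[of h l' a b'] z' b' \<open>l' = l\<close> by metis
  then show False using z' zl by blast
qed

text \<open>The Veblen-Young axiom in projected form: the line \<open>pw\<close> meets
  \<open>ab\<close> when \<open>w\<close> lies on a line joining a point of \<open>pa\<close> to a
  point of \<open>pb\<close>. As \<open>p\<close> is off the line \<open>c\<close>, which is the
  double perp of \<open>a\<close> and \<open>b\<close>, some \<open>x\<close> is collinear with
  \<open>a\<close> and \<open>b\<close> but not with \<open>p\<close>. The projection
  \<open>z\<close> of \<open>w\<close> into \<open>hyperbolic_perp p x\<close> lies in the double
  perp of \<open>a\<close> and \<open>b\<close> taken there, hence on \<open>c\<close>.\<close>

lemma triangle_projection:
  assumes p: "p \<in> P" and c: "c \<in> L" "a \<in> c" "b \<in> c" "a \<noteq> b" "p \<notin> c"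
    and u: "h \<in> L" "p \<in> h" "a \<in> h" "u \<in> h" "u \<noteq> p"
    and v: "g \<in> L" "p \<in> g" "b \<in> g" "v \<in> g" "v \<noteq> p"
    and d: "d \<in> L" "u \<in> d" "v \<in> d" "u \<noteq> v" "w \<in> d"
  shows "\<exists>t\<in>c. \<exists>l\<in>L. p \<in> l \<and> t \<in> l \<and> w \<in> l"
proof (cases "w = p")
  case True
  then show ?thesis using c u by blast
next
  case False
  have P: "a \<in> P" "b \<in> P" "u \<in> P" "v \<in> P" "w \<in> P" using c u v d line_sub by blast+
  obtain x where x: "x \<in> P" "perp L a x" "perp L b x" "\<not> perp L p x"
    using line_bi_perp[OF P(1,2) p c(1-4)] c(5) by blast
  have ppw: "perp L p w"
    by (rule perp_all[OF p d(1-4) _ _ d(5)]) (use u v perp_line in metis)+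
  from hyperbolic_proj[OF p x(1) x(4) False ppw] obtain l z
    where z: "l \<in> L" "p \<in> l" "w \<in> l" "z \<in> l" "z \<noteq> p" "z \<in> hyperbolic_perp p x" .
  interpret R: weak_polar "hyperbolic_perp p x" "hyperbolic_lines p x"
    by (rule weak_polar_hyperbolic[OF p x(1,4)])
  have ab: "a \<in> hyperbolic_perp p x" "b \<in> hyperbolic_perp p x"
    using x P u v perp_sym perp_line unfolding hyperbolic_perp_def mem_Collect_eq by metis+
  have "z \<in> c"
  proof (rule R.line_bi_perp[OF ab z(6) hyperbolic_perp_line[OF p x(1) ab c(4) c(1-3)] c(2-4)])
    fix y assume y: "y \<in> hyperbolic_perp p x"
      "perp (hyperbolic_lines p x) a y" "perp (hyperbolic_lines p x) b y"
    have y': "y \<in> P" "perp L y p" using y perp_sym by (auto simp: hyperbolic_perp_def)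
    have "perp L y a" "perp L y b"
      using y perp_hyperbolic[OF p x(1)] ab perp_sym by metis+
    then have "perp L y u" "perp L y v"
      using perp_all[of y h a p u] perp_all[of y g b p v] u v c y' by metis+
    then have "perp L y w" using perp_all[of y d u v w] d y' by metis
    then have "perp L y z" using perp_all[of y l w p z] z y' False by metis
    then show "perp (hyperbolic_lines p x) z y"
      using y perp_hyperbolic[OF p x(1) z(6) y(1)] perp_sym by metis
  qed
  then show ?thesis using z by blast
qed

end

section \<open>Rank in modular exchange closures\<close>

text \<open>Covers both the linear span and the span of points inside a singular subspace. The axiom
  \<open>cl_insert\<close> says that joining a point to a flat amounts to drawing lines; it makes the lattice of
  flats modular.\<close>

locale exchange_closure =
  fixes E :: "'a set" and cl :: "'a set \<Rightarrow> 'a set"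
  assumes cl_ext: "A \<subseteq> E \<Longrightarrow> A \<subseteq> cl A"
    and cl_in: "A \<subseteq> E \<Longrightarrow> cl A \<subseteq> E"
    and cl_mono: "A \<subseteq> B \<Longrightarrow> B \<subseteq> E \<Longrightarrow> cl A \<subseteq> cl B"
    and cl_idem: "A \<subseteq> E \<Longrightarrow> cl (cl A) = cl A"
    and exchange: "\<lbrakk>A \<subseteq> E; x \<in> E; y \<in> cl (insert x A); y \<notin> cl A\<rbrakk> \<Longrightarrow> x \<in> cl (insert y A)"
    and cl_insert: "\<lbrakk>A \<subseteq> E; cl A = A; p \<in> E; x \<in> cl (insert p A)\<rbrakk>
       \<Longrightarrow> x \<in> cl {p} \<or> (\<exists>a\<in>A. x \<in> cl {a, p})"
    and finite_generated: "\<exists>B. finite B \<and> B \<subseteq> E \<and> cl B = E"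
begin

definition flat :: "'a set \<Rightarrow> bool" where
  "flat S \<longleftrightarrow> S \<subseteq> E \<and> cl S = S"

definition indep :: "'a set \<Rightarrow> bool" where
  "indep B \<longleftrightarrow> (\<forall>x\<in>B. x \<notin> cl (B - {x}))"

definition basis :: "'a set \<Rightarrow> 'a set \<Rightarrow> bool" where
  "basis S B \<longleftrightarrow> finite B \<and> B \<subseteq> E \<and> indep B \<and> cl B = S"

definition rk :: "'a set \<Rightarrow> nat" where
  "rk S = (THE d. \<exists>B. basis S B \<and> card B = d)"

definition join :: "'a set \<Rightarrow> 'a set \<Rightarrow> 'a set" where
  "join A B = cl (A \<union> B)"

section \<open>Flats, independent sets and rank\<close>

lemma cl_least: "A \<subseteq> cl B \<Longrightarrow> B \<subseteq> E \<Longrightarrow> cl A \<subseteq> cl B"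
  using cl_mono[of A "cl B"] cl_idem cl_in by blast

lemma flat_cl: "A \<subseteq> E \<Longrightarrow> flat (cl A)"
  using cl_in cl_idem by (auto simp: flat_def)

lemma flat_least: "flat S \<Longrightarrow> A \<subseteq> S \<Longrightarrow> cl A \<subseteq> S"
  using cl_mono[of A S] by (auto simp: flat_def)

lemma flat_E: "flat E"
  using cl_ext cl_in by (auto simp: flat_def)

lemma flat_Int: "flat A \<Longrightarrow> flat B \<Longrightarrow> flat (A \<inter> B)"
  using flat_least[of A "A \<inter> B"] flat_least[of B "A \<inter> B"] cl_ext[of "A \<inter> B"]
  by (auto simp: flat_def)

lemma flat_join: "flat A \<Longrightarrow> flat B \<Longrightarrow> flat (join A B)"
  using flat_cl[of "A \<union> B"] by (simp add: join_def flat_def)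

lemma join_upper: "flat A \<Longrightarrow> flat B \<Longrightarrow> A \<subseteq> join A B \<and> B \<subseteq> join A B"
  using cl_ext[of "A \<union> B"] by (auto simp: join_def flat_def)

lemma join_least: "flat C \<Longrightarrow> A \<subseteq> C \<Longrightarrow> B \<subseteq> C \<Longrightarrow> join A B \<subseteq> C"
  using flat_least[of C "A \<union> B"] by (auto simp: join_def)

lemma indep_subset: "indep B \<Longrightarrow> A \<subseteq> B \<Longrightarrow> B \<subseteq> E \<Longrightarrow> indep A"
  unfolding indep_def using cl_mono[of "A - {x}" "B - {x}" for x] by blast

lemma indep_insert:
  assumes I: "indep I" "I \<subseteq> E" and b: "b \<in> E" "b \<notin> cl I"
  shows "indep (insert b I)"
  unfolding indep_def
proof
  fix y assume y: "y \<in> insert b I"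
  have bI: "b \<notin> I" using cl_ext I b by blast
  show "y \<notin> cl (insert b I - {y})"
  proof (cases "y = b")
    case True
    then show ?thesis using b bI by simp
  next
    case False
    then have yI: "y \<in> I" using y by simp
    then have "y \<notin> cl (I - {y})" using I by (simp add: indep_def)
    moreover have "insert b I - {y} = insert b (I - {y})" using False by blast
    moreover have "insert y (I - {y}) = I" using yI by blast
    ultimately show ?thesis using exchange[of "I - {y}" b y] I b by auto
  qed
qed

text \<open>Steinitz exchange, by induction on the size of \<open>I - B\<close>. For
  \<open>x\<close> in \<open>I - B\<close>, some \<open>b\<close> in \<open>B\<close> lies outside
  the closure of \<open>I - {x}\<close>, since otherwise that closure would contain
  \<open>x\<close>; then \<open>b\<close> replaces \<open>x\<close>.\<close>

lemma indep_card_le: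
  assumes "finite B" "B \<subseteq> E" "finite I" "indep I" "I \<subseteq> cl B"
  shows "card I \<le> card B"
  using assms(3-5)
proof (induction "card (I - B)" arbitrary: I rule: less_induct)
  case less
  show ?case
  proof (cases "I \<subseteq> B")
    case True
    then show ?thesis using assms card_mono by blast
  next
    case False
    then obtain x where x: "x \<in> I" "x \<notin> B" by blast
    let ?J = "I - {x}"
    have IE: "I \<subseteq> E" using less cl_in assms by blast
    have "\<not> B \<subseteq> cl ?J"
    proof
      assume "B \<subseteq> cl ?J"
      then have "cl B \<subseteq> cl ?J" using cl_least[of B ?J] IE by blast
      then show False using less x by (auto simp: indep_def)
    qed
    then obtain b where b: "b \<in> B" "b \<notin> cl ?J" by blast
    have bJ: "b \<notin> ?J" using b cl_ext[of ?J] IE by blast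
    have ind: "indep (insert b ?J)"
      using indep_insert[of ?J b] indep_subset[of I ?J] less(3) IE b assms by blast
    have "insert b ?J - B \<subset> I - B" using x b by auto
    then have "card (insert b ?J - B) < card (I - B)"
      using less(2) by (simp add: psubset_card_mono)
    moreover have "insert b ?J \<subseteq> cl B" using less(4) b cl_ext assms by blast
    ultimately have "card (insert b ?J) \<le> card B"
      using less(1)[of "insert b ?J"] ind less(2) by auto
    moreover have "card (insert b ?J) = card I"
      using bJ x less(2) by (metis card_insert_disjoint card_Suc_Diff1 finite_Diff)
    ultimately show ?thesis by simp
  qed
qed

lemma basis_card_unique:
  assumes "basis S B" "basis S B'" shows "card B = card B'"
  using indep_card_le[of B B'] indep_card_le[of B' B] assms cl_ext
  by (metis basis_def order_antisym)

lemma rk_basis: "basis S B \<Longrightarrow> rk S = card B"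
  unfolding rk_def using basis_card_unique by blast

lemma indep_finite:
  assumes "indep I" "I \<subseteq> E" shows "finite I"
proof (rule ccontr)
  assume inf: "infinite I"
  obtain B where B: "finite B" "B \<subseteq> E" "cl B = E" using finite_generated by blast
  obtain J where J: "J \<subseteq> I" "finite J" "card J = Suc (card B)"
    using infinite_arbitrarily_large[OF inf] by blast
  have "card J \<le> card B"
    using indep_card_le[of B J] indep_subset[of I J] assms B J by blast
  then show False using J by simp
qed

text \<open>An independent set of greatest size between \<open>I\<close> and \<open>S\<close> spans
  \<open>S\<close>; sizes are bounded by \<open>indep_card_le\<close>.\<close>

lemma basis_extend:
  assumes "indep I" "I \<subseteq> S" "flat S"
  shows "\<exists>B. I \<subseteq> B \<and> basis S B"
proof -
  obtain B where B: "finite B" "B \<subseteq> E" "cl B = E" using finite_generated by blast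
  let ?F = "\<lambda>J. I \<subseteq> J \<and> indep J \<and> J \<subseteq> S"
  have SE: "S \<subseteq> E" using assms by (simp add: flat_def)
  have bd: "\<forall>J. ?F J \<longrightarrow> card J < Suc (card B)"
    using indep_card_le[of B] indep_finite B SE by (metis le_imp_less_Suc subset_trans)
  have "?F I" using assms by blast
  from ex_has_greatest_nat[of ?F, OF this bd]
  obtain J where J: "?F J" "\<And>K. ?F K \<Longrightarrow> card K \<le> card J" by blast
  have JE: "J \<subseteq> E" using J SE by blast
  have "S \<subseteq> cl J"
  proof
    fix b assume b: "b \<in> S"
    show "b \<in> cl J"
    proof (rule ccontr)
      assume nb: "b \<notin> cl J"
      have "?F (insert b J)" using indep_insert[of J b] J JE b SE nb by blast
      then have "card (insert b J) \<le> card J" using J(2) by blast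
      moreover have "b \<notin> J" using nb cl_ext JE by blast
      moreover have "finite J" using indep_finite J JE by blast
      ultimately show False by simp
    qed
  qed
  moreover have "cl J \<subseteq> S" using flat_least assms J by blast
  ultimately show ?thesis
    using J JE indep_finite by (auto simp: basis_def)
qed

lemma basis_exists: "flat S \<Longrightarrow> \<exists>B. basis S B"
  using basis_extend[of "{}" S] by (auto simp: indep_def)

lemma basis_iff_rk: "flat S \<Longrightarrow> (\<exists>B. basis S B \<and> card B = d) \<longleftrightarrow> rk S = d"
  using basis_exists rk_basis by metis

lemma rk_mono: "flat S \<Longrightarrow> flat T \<Longrightarrow> S \<subseteq> T \<Longrightarrow> rk S \<le> rk T"
proof -
  assume *: "flat S" "flat T" "S \<subseteq> T"
  obtain B where B: "basis S B" using basis_exists * by blast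
  then have "B \<subseteq> S" using cl_ext by (auto simp: basis_def)
  then obtain B' where B': "B \<subseteq> B'" "basis T B'"
    using basis_extend[of B T] B * by (auto simp: basis_def)
  then have "card B \<le> card B'" using card_mono[OF _ B'(1)] by (simp add: basis_def)
  then show ?thesis using rk_basis[OF B] rk_basis[OF B'(2)] by simp
qed

lemma rk_insert:
  assumes S: "flat S" and x: "x \<in> E" "x \<notin> S"
  shows "rk (cl (insert x S)) = Suc (rk S)"
proof -
  obtain B where B: "basis S B" using basis_exists S by blast
  have BE: "B \<subseteq> E" "finite B" "indep B" "cl B = S" using B by (auto simp: basis_def)
  have BS: "B \<subseteq> S" using cl_ext BE by blast
  have "S \<subseteq> cl (insert x B)" using BE cl_mono[of B "insert x B"] x by blast
  moreover have "x \<in> cl (insert x B)" using cl_ext[of "insert x B"] BE x by blast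
  ultimately have "cl (insert x S) \<subseteq> cl (insert x B)"
    using cl_least[of "insert x S" "insert x B"] BE x by blast
  moreover have "cl (insert x B) \<subseteq> cl (insert x S)"
    using cl_mono[of "insert x B" "insert x S"] BS S x by (auto simp: flat_def)
  ultimately have "basis (cl (insert x S)) (insert x B)"
    using indep_insert[of B x] BE x by (auto simp: basis_def)
  then have "rk (cl (insert x S)) = card (insert x B)" by (rule rk_basis)
  then show ?thesis using BE x BS rk_basis[OF B] by (metis card_insert_disjoint subsetD)
qed

lemma rk_strict:
  assumes "flat S" "flat T" "S \<subset> T" shows "rk S < rk T"
proof -
  obtain x where x: "x \<in> T" "x \<notin> S" using assms by blast
  have "x \<in> E" using x assms by (auto simp: flat_def)
  moreover have "cl (insert x S) \<subseteq> T" using flat_least assms x by blast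
  moreover have "flat (cl (insert x S))"
    using flat_cl \<open>x \<in> E\<close> assms by (simp add: flat_def)
  ultimately show ?thesis
    using rk_insert[OF assms(1) _ x(2)] rk_mono[of "cl (insert x S)" T] assms by simp
qed

lemma rk_eq: "flat S \<Longrightarrow> flat T \<Longrightarrow> S \<subseteq> T \<Longrightarrow> rk S = rk T \<Longrightarrow> S = T"
  using rk_strict by fastforce

text \<open>\<open>cl_insert\<close> iterated over the generators of the second flat: a join of two
  flats consists of the flats and the lines that connect them.\<close>

lemma cl_Un:
  assumes A: "flat A" and F: "finite F" "F \<subseteq> E" and x: "x \<in> cl (A \<union> F)"
  shows "x \<in> A \<or> x \<in> cl F \<or> (\<exists>a\<in>A. \<exists>b\<in>cl F. x \<in> cl {a, b})"
  using F x
proof (induction F arbitrary: x rule: finite_induct)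
  case empty
  then show ?case using A by (simp add: flat_def)
next
  case (insert p F)
  have AE: "A \<subseteq> E" using A by (simp add: flat_def)
  have pE: "p \<in> E" "F \<subseteq> E" using insert by auto
  let ?C = "cl (A \<union> F)"
  have C: "flat ?C" using flat_cl AE pE by simp
  have "A \<union> insert p F \<subseteq> insert p ?C" using cl_ext[of "A \<union> F"] AE pE by blast
  then have "x \<in> cl (insert p ?C)"
    using insert.prems(2) cl_mono[of "A \<union> insert p F" "insert p ?C"] C pE by (auto simp: flat_def)
  then have "x \<in> cl {p} \<or> (\<exists>y\<in>?C. x \<in> cl {y, p})"
    using cl_insert[of ?C p x] C pE by (auto simp: flat_def)
  moreover have pF: "cl {p} \<subseteq> cl (insert p F)" "cl F \<subseteq> cl (insert p F)" "p \<in> cl (insert p F)"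
    using cl_mono[of "{p}" "insert p F"] cl_mono[of F "insert p F"] cl_ext[of "insert p F"] pE by auto
  moreover have ?case if y: "y \<in> ?C" "x \<in> cl {y, p}" for y
  proof -
    from insert.IH[OF pE(2) y(1)] consider "y \<in> A" | "y \<in> cl F"
      | a b where "a \<in> A" "b \<in> cl F" "y \<in> cl {a, b}" by blast
    then show ?thesis
    proof cases
      case 1
      then show ?thesis using y pF by blast
    next
      case 2
      then have "cl {y, p} \<subseteq> cl (insert p F)"
        using cl_least[of "{y, p}" "insert p F"] pF pE by blast
      then show ?thesis using y by blast
    next
      case 3
      \<comment> \<open>Here \<open>x\<close> lies in the span of \<open>a\<close>,
        \<open>b\<close>, \<open>p\<close>. Adding \<open>a\<close> last instead of \<open>p\<close>
        puts \<open>x\<close> on a line from \<open>a\<close> to a point of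
        \<open>?D\<close>.\<close>
      let ?D = "cl {b, p}"
      have bE: "b \<in> E" "a \<in> E" using 3 cl_in pE AE by blast+
      have D: "flat ?D" using flat_cl[of "{b, p}"] bE pE by blast
      have bD: "b \<in> ?D" "p \<in> ?D" using cl_ext[of "{b, p}"] bE pE by auto
      have "y \<in> cl (insert a ?D)"
        using 3(3) cl_mono[of "{a, b}" "insert a ?D"] bD bE D by (auto simp: flat_def)
      moreover have "p \<in> cl (insert a ?D)"
        using cl_ext[of "insert a ?D"] bD bE D by (auto simp: flat_def)
      ultimately have "cl {y, p} \<subseteq> cl (insert a ?D)"
        using cl_least[of "{y, p}" "insert a ?D"] bE D by (auto simp: flat_def)
      then have "x \<in> cl {a} \<or> (\<exists>d\<in>?D. x \<in> cl {d, a})"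
        using cl_insert[of ?D a x] y D bE by (auto simp: flat_def)
      then have "x \<in> cl {a} \<or> (\<exists>d\<in>?D. x \<in> cl {a, d})"
        by (metis insert_commute)
      moreover have "?D \<subseteq> cl (insert p F)"
        using cl_least[of "{b, p}" "insert p F"] 3 pF pE by blast
      moreover have "cl {a} \<subseteq> A" using flat_least[OF A] 3 by blast
      ultimately show ?thesis using 3 by blast
    qed
  qed
  ultimately show ?case by blast
qed

text \<open>By \<open>cl_Un\<close> the point \<open>x\<close> may be taken on a line from
  \<open>a\<close> in \<open>A\<close> to \<open>b\<close> in \<open>B\<close>, and not in
  \<open>A\<close>. As \<open>x\<close> and \<open>a\<close> lie in \<open>C\<close>, exchange puts
  \<open>b\<close> in \<open>C\<close> too, so \<open>b\<close> is in
  \<open>B \<inter> C\<close>.\<close>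

lemma modular_law:
  assumes A: "flat A" and B: "flat B" and C: "flat C" "A \<subseteq> C"
  shows "join A B \<inter> C \<subseteq> join A (B \<inter> C)"
proof
  fix x assume x: "x \<in> join A B \<inter> C"
  have E: "A \<subseteq> E" "B \<subseteq> E" "C \<subseteq> E" using A B C by (auto simp: flat_def)
  obtain F where F: "basis B F" using basis_exists B by blast
  have F': "finite F" "F \<subseteq> E" "cl F = B" using F by (auto simp: basis_def)
  have up: "A \<subseteq> join A (B \<inter> C)" "B \<inter> C \<subseteq> join A (B \<inter> C)"
    using join_upper A flat_Int B C by blast+
  have "A \<union> B \<subseteq> cl (A \<union> F)"
    using F' cl_mono[of F "A \<union> F"] cl_ext[of "A \<union> F"] E by auto
  then have "x \<in> cl (A \<union> F)"
    using x cl_least[of "A \<union> B" "A \<union> F"] E F' by (auto simp: join_def)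
  with cl_Un[OF A F'(1,2)] F'(3)
  consider "x \<in> A" | "x \<in> B" | a b where "a \<in> A" "b \<in> B" "x \<in> cl {a, b}" "x \<notin> A" by blast
  then show "x \<in> join A (B \<inter> C)"
  proof cases
    case 3
    have "x \<notin> cl {a}" using 3 flat_least[OF A, of "{a}"] by blast
    then have "b \<in> cl {x, a}"
      using exchange[of "{a}" b x] 3 E by (auto simp: insert_commute)
    moreover have "cl {x, a} \<subseteq> C" using flat_least[OF C(1), of "{x, a}"] x 3 C by blast
    ultimately have "b \<in> join A (B \<inter> C)" "a \<in> join A (B \<inter> C)" using 3 up by auto
    then have "cl {a, b} \<subseteq> join A (B \<inter> C)"
      using flat_least[of "join A (B \<inter> C)" "{a, b}"] flat_join flat_Int A B C by blast
    then show ?thesis using 3 by blast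
  qed (use x up in auto)
qed

lemma join_insert:
  assumes "flat A" "flat B" "x \<in> E"
  shows "join A (cl (insert x B)) = cl (insert x (join A B))"
proof
  have E: "A \<subseteq> E" "B \<subseteq> E" using assms by (auto simp: flat_def)
  have jE: "join A B \<subseteq> E" using flat_join assms by (simp add: flat_def)
  have "A \<union> insert x B \<subseteq> cl (insert x (join A B))"
    using join_upper[OF assms(1,2)] cl_ext[of "insert x (join A B)"] jE assms by blast
  moreover have "cl (insert x B) \<subseteq> cl (insert x (join A B))"
    using cl_least[of "insert x B" "insert x (join A B)"] calculation jE assms by blast
  ultimately show "join A (cl (insert x B)) \<subseteq> cl (insert x (join A B))"
    using join_least[of "cl (insert x (join A B))"] flat_cl jE assms by auto
  have f: "flat (cl (insert x B))" using flat_cl E assms by simp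
  have "insert x B \<subseteq> cl (insert x B)" using cl_ext[of "insert x B"] E assms by blast
  then have "insert x B \<subseteq> join A (cl (insert x B))" using join_upper[OF assms(1) f] by blast
  moreover have "A \<subseteq> join A (cl (insert x B))" using join_upper[OF assms(1) f] by blast
  ultimately have "insert x (join A B) \<subseteq> join A (cl (insert x B))"
    using join_least[OF flat_join[OF assms(1) f]] by auto
  then show "cl (insert x (join A B)) \<subseteq> join A (cl (insert x B))"
    using flat_least flat_join[OF assms(1) f] by blast
qed

text \<open>The flat \<open>C\<close> grows from \<open>A \<inter> B\<close> to \<open>B\<close>.
  Each unit of rank that \<open>C\<close> gains is also gained by \<open>join A C\<close>, because
  of the modular law.\<close>

lemma rk_modular:
  assumes A: "flat A" and B: "flat B"
  shows "rk (A \<inter> B) + rk (join A B) = rk A + rk B"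
proof -
  have "rk (join A C) + rk (A \<inter> B) = rk A + rk C"
    if "flat C" "A \<inter> B \<subseteq> C" "C \<subseteq> B" "rk C = rk (A \<inter> B) + d" for C d
    using that
  proof (induction d arbitrary: C)
    case 0
    then have "C = A \<inter> B" using rk_eq[of "A \<inter> B" C] flat_Int A B by auto
    then have "join A C = A"
      using join_least[OF A, of A C] join_upper[OF A, of C] 0 by blast
    then show ?case using \<open>C = A \<inter> B\<close> by simp
  next
    case (Suc d)
    let ?I = "A \<inter> B"
    have I: "flat ?I" using flat_Int A B by blast
    obtain F where F: "basis ?I F" using basis_exists I by blast
    have F': "F \<subseteq> ?I" "F \<subseteq> E" "indep F" "finite F" using F cl_ext by (auto simp: basis_def)
    obtain G where G: "F \<subseteq> G" "basis C G"
      using basis_extend[of F C] F' Suc.prems by blast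
    have G': "G \<subseteq> E" "indep G" "finite G" "cl G = C" using G by (auto simp: basis_def)
    have "card F < card G" using rk_basis[OF F] rk_basis[OF G(2)] Suc.prems by simp
    then have "\<not> G \<subseteq> F" using G(1) by auto
    then obtain x where x: "x \<in> G" "x \<notin> F" by blast
    \<comment> \<open>A hyperplane of \<open>C\<close> that still contains
      \<open>A \<inter> B\<close>: the basis \<open>G\<close> of \<open>C\<close> extends the basis
      \<open>F\<close> of \<open>A \<inter> B\<close>, and \<open>x\<close> lies outside
      \<open>F\<close>.\<close>
    define D where "D = cl (G - {x})"
    have xD: "x \<notin> D" using G' x by (simp add: indep_def D_def)
    have xE: "x \<in> E" using x G' by blast
    have D: "flat D" using flat_cl[of "G - {x}"] G' by (auto simp: D_def)
    have GD: "G - {x} \<subseteq> D" using cl_ext[of "G - {x}"] G' by (auto simp: D_def)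
    have DC: "D \<subseteq> C" using cl_mono[of "G - {x}" G] G' by (auto simp: D_def)
    have ID: "?I \<subseteq> D"
      using F cl_mono[of F "G - {x}"] x G G' by (auto simp: D_def basis_def)
    have "G \<subseteq> insert x D" using GD by blast
    then have C: "C = cl (insert x D)"
      using cl_mono[of G "insert x D"] flat_least[OF Suc.prems(1), of "insert x D"] DC G' xE x
        cl_ext[of G] D by (auto simp: flat_def)
    have rD: "rk C = Suc (rk D)" using rk_insert[OF D xE xD] C by simp
    have IH: "rk (join A D) + rk ?I = rk A + rk D"
      using Suc.IH[OF D ID] DC Suc.prems rD by simp
    have "x \<notin> join A D"
    proof
      \<comment> \<open>As \<open>x\<close> lies in \<open>C\<close>, the modular law for
        \<open>D \<subseteq> C\<close> would put it in the join of \<open>D\<close> and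
        \<open>A \<inter> C\<close>, which is \<open>D\<close>.\<close>
      assume xj: "x \<in> join A D"
      have xC: "x \<in> C" using x cl_ext G' by blast
      have "join D A \<inter> C \<subseteq> join D (A \<inter> C)"
        using modular_law[OF D A Suc.prems(1) DC] .
      moreover have "A \<inter> C \<subseteq> D" using ID Suc.prems by blast
      then have "join D (A \<inter> C) \<subseteq> D" using join_least[OF D] by blast
      moreover have "join D A = join A D" by (simp add: join_def Un_commute)
      ultimately show False using xj xC xD by blast
    qed
    then have "rk (join A C) = Suc (rk (join A D))"
      using join_insert[OF A D xE] rk_insert[OF flat_join[OF A D] xE] C by simp
    then show ?case using IH rD by simp
  qed
  from this[of B "rk B - rk (A \<inter> B)"] rk_mono[of "A \<inter> B" B] show ?thesis
    using flat_Int[OF A B] B by simp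
qed

lemma flat_atom:
  assumes "flat S" "flat T" "S \<subset> T"
  shows "\<exists>R. flat R \<and> S \<subseteq> R \<and> R \<subseteq> T \<and> rk R = Suc (rk S)"
proof -
  obtain x where x: "x \<in> T" "x \<notin> S" using assms by blast
  have "x \<in> E" "S \<subseteq> E" using x assms by (auto simp: flat_def)
  then show ?thesis
    using rk_insert[OF assms(1) _ x(2)] flat_least[OF assms(2), of "insert x S"] x assms
      flat_cl[of "insert x S"] cl_ext[of "insert x S"] by blast
qed

text \<open>Take \<open>Y\<close> of greatest rank among the flats of \<open>B\<close> that meet
  \<open>X\<close> in \<open>A\<close>. A point of \<open>B\<close> outside the join of
  \<open>X\<close> and \<open>Y\<close> could be added to \<open>Y\<close> without enlarging the
  intersection, by exchange.\<close>

lemma flat_complement: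
  assumes "flat A" "flat X" "flat B" "A \<subseteq> X" "X \<subseteq> B"
  shows "\<exists>Y. flat Y \<and> X \<inter> Y = A \<and> join X Y = B"
proof -
  let ?F = "\<lambda>Y. flat Y \<and> X \<inter> Y = A \<and> Y \<subseteq> B"
  have bd: "\<forall>Y. ?F Y \<longrightarrow> rk Y < Suc (rk B)"
    using rk_mono assms by (simp add: less_Suc_eq_le)
  have "?F A" using assms by blast
  from ex_has_greatest_nat[of ?F, OF this bd]
  obtain Y where Y: "?F Y" "\<And>Z. ?F Z \<Longrightarrow> rk Z \<le> rk Y" by blast
  have "B \<subseteq> join X Y"
  proof
    fix p assume p: "p \<in> B"
    show "p \<in> join X Y"
    proof (rule ccontr)
      assume np: "p \<notin> join X Y"
      have up: "X \<subseteq> join X Y" "Y \<subseteq> join X Y" using join_upper assms Y by blast+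
      have pE: "p \<in> E" "Y \<subseteq> E" using p assms Y by (auto simp: flat_def)
      have pY: "p \<notin> Y" using np up by blast
      let ?Z = "cl (insert p Y)"
      have YZ: "Y \<subseteq> ?Z" using cl_ext[of "insert p Y"] pE by blast
      have "X \<inter> ?Z \<subseteq> A"
      proof
        fix q assume q: "q \<in> X \<inter> ?Z"
        show "q \<in> A"
        proof (rule ccontr)
          assume "q \<notin> A"
          then have "q \<notin> cl Y" using q Y by (auto simp: flat_def)
          then have "p \<in> cl (insert q Y)" using exchange[of Y p q] pE q by blast
          moreover have "cl (insert q Y) \<subseteq> join X Y"
            using flat_least[OF flat_join[of X Y], of "insert q Y"] assms Y up q by blast
          ultimately show False using np by blast
        qed
      qed
      then have "X \<inter> ?Z = A" using Y(1) YZ by auto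
      moreover have "flat ?Z" using flat_cl[of "insert p Y"] pE by simp
      moreover have "?Z \<subseteq> B" using flat_least[OF assms(3), of "insert p Y"] Y(1) p by simp
      ultimately have "?F ?Z" by blast
      then have "rk ?Z \<le> rk Y" using Y(2) by blast
      then show False using rk_insert[of Y p] Y pE pY by simp
    qed
  qed
  moreover have "join X Y \<subseteq> B" using join_least assms Y by blast
  ultimately show ?thesis using Y by blast
qed

end

section \<open>Vector spaces over division rings\<close>

context left_vector_space
begin

lemma scale_zero_left: "scale 0 x = 0"
  using scale_left_distrib[of 0 0 x] by simp

lemma scale_zero_right: "scale a 0 = 0"
  using scale_right_distrib[of a 0 0] by simp

lemma scale_minus_one: "scale (- 1) x = - x"
  using scale_left_distrib[of "- 1" 1 x] scale_zero_left scale_one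
  by (simp add: eq_neg_iff_add_eq_0)

definition span :: "'v set \<Rightarrow> 'v set" where
  "span A = \<Inter> {W. lin_subspace scale W \<and> A \<subseteq> W}"

lemma lin_subspace_span: "lin_subspace scale (span A)"
  by (auto simp: span_def lin_subspace_def)

lemma span_superset: "A \<subseteq> span A"
  by (auto simp: span_def)

lemma span_least: "lin_subspace scale W \<Longrightarrow> A \<subseteq> W \<Longrightarrow> span A \<subseteq> W"
  by (auto simp: span_def)

lemma span_subspace: "lin_subspace scale W \<Longrightarrow> span W = W"
  using span_least[of W W] span_superset[of W] by blast

lemma span_mono: "A \<subseteq> B \<Longrightarrow> span A \<subseteq> span B"
  using span_least[OF lin_subspace_span, of A B] span_superset[of B] by blast

lemma lin_subspace_scale: "lin_subspace scale W \<Longrightarrow> x \<in> W \<Longrightarrow> scale a x \<in> W"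
  by (simp add: lin_subspace_def)

lemma lin_subspace_add: "lin_subspace scale W \<Longrightarrow> x \<in> W \<Longrightarrow> y \<in> W \<Longrightarrow> x + y \<in> W"
  by (simp add: lin_subspace_def)

lemma lin_subspace_diff:
  "lin_subspace scale W \<Longrightarrow> x \<in> W \<Longrightarrow> y \<in> W \<Longrightarrow> x - y \<in> W"
  using lin_subspace_add[of W x "- y"] lin_subspace_scale[of W y "- 1"] scale_minus_one[of y] by simp

lemma lin_subspace_sum:
  assumes "lin_subspace scale W" "\<And>b. b \<in> B \<Longrightarrow> g b \<in> W"
  shows "(\<Sum>b\<in>B. g b) \<in> W"
  using assms(2)
  by (induction B rule: infinite_finite_induct) (use assms(1) in \<open>auto simp: lin_subspace_def\<close>)

lemma span_insert: "span (insert x A) = {scale c x + a | c a. a \<in> span A}"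
proof
  let ?W = "{scale c x + a | c a. a \<in> span A}"
  have "lin_subspace scale ?W"
    unfolding lin_subspace_def
  proof (intro conjI ballI allI)
    show "0 \<in> ?W"
      using lin_subspace_span[of A] scale_zero_left[of x] by (force simp: lin_subspace_def)
  next
    fix u v assume "u \<in> ?W" "v \<in> ?W"
    then obtain c a d b where *: "u = scale c x + a" "v = scale d x + b" "a \<in> span A" "b \<in> span A"
      by blast
    have "u + v = scale (c + d) x + (a + b)"
      by (simp add: * scale_left_distrib algebra_simps)
    moreover have "a + b \<in> span A" using * lin_subspace_span[of A] by (auto simp: lin_subspace_def)
    ultimately show "u + v \<in> ?W" by blast
  next
    fix r u assume "u \<in> ?W"
    then obtain c a where *: "u = scale c x + a" "a \<in> span A" by blast
    have "scale r u = scale (r * c) x + scale r a"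
      by (simp add: * scale_right_distrib scale_scale)
    moreover have "scale r a \<in> span A" using * lin_subspace_span[of A] by (auto simp: lin_subspace_def)
    ultimately show "scale r u \<in> ?W" by blast
  qed
  moreover have "insert x A \<subseteq> ?W"
  proof
    fix y assume "y \<in> insert x A"
    then consider "y = x" | "y \<in> A" by blast
    then show "y \<in> ?W"
    proof cases
      case 1
      then have "y = scale 1 x + 0" by (simp add: scale_one)
      moreover have "0 \<in> span A" using lin_subspace_span[of A] by (simp add: lin_subspace_def)
      ultimately show ?thesis by blast
    next
      case 2
      then have "y = scale 0 x + y" "y \<in> span A" using span_superset by (auto simp: scale_zero_left)
      then show ?thesis by blast
    qed
  qed
  ultimately show "span (insert x A) \<subseteq> ?W" by (rule span_least)
next
  have x: "x \<in> span (insert x A)" and A: "span A \<subseteq> span (insert x A)"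
    using span_superset[of "insert x A"] span_mono[of A "insert x A"] by blast+
  have "scale c x + a \<in> span (insert x A)" if "a \<in> span A" for c a
    using lin_subspace_add lin_subspace_scale lin_subspace_span x A that by (meson subsetD)
  then show "{scale c x + a | c a. a \<in> span A} \<subseteq> span (insert x A)"
    by auto
qed

lemma span_finite:
  assumes "finite B" shows "span B = range (\<lambda>c. \<Sum>b\<in>B. scale (c b) b)"
  using assms
proof (induction B rule: finite_induct)
  case empty
  have "lin_subspace scale {0}" by (simp add: lin_subspace_def scale_zero_right)
  then have "span {} \<subseteq> {0}" by (rule span_least) simp
  moreover have "0 \<in> span {}" using lin_subspace_span[of "{}"] by (simp add: lin_subspace_def)
  ultimately show ?case by auto
next
  case (insert x B)
  show ?case
  proof
    show "span (insert x B) \<subseteq> range (\<lambda>c. \<Sum>b\<in>insert x B. scale (c b) b)"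
    proof
      fix y assume "y \<in> span (insert x B)"
      then obtain r c where y: "y = scale r x + (\<Sum>b\<in>B. scale (c b) b)"
        unfolding span_insert insert.IH by blast
      have "(\<Sum>b\<in>B. scale ((c(x := r)) b) b) = (\<Sum>b\<in>B. scale (c b) b)"
        by (rule sum.cong) (use insert in auto)
      then have "y = (\<Sum>b\<in>insert x B. scale ((c(x := r)) b) b)"
        using insert y by simp
      then show "y \<in> range (\<lambda>c. \<Sum>b\<in>insert x B. scale (c b) b)" by blast
    qed
  next
    show "range (\<lambda>c. \<Sum>b\<in>insert x B. scale (c b) b) \<subseteq> span (insert x B)"
      using span_superset[of "insert x B"] lin_subspace_span[of "insert x B"] insert.hyps
      by (intro image_subsetI lin_subspace_sum[OF lin_subspace_span])
        (auto simp: lin_subspace_def)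
  qed
qed

lemma span_exchange:
  assumes "y \<in> span (insert x A)" "y \<notin> span A" shows "x \<in> span (insert y A)"
proof -
  obtain c a where y: "y = scale c x + a" "a \<in> span A"
    using assms(1) by (auto simp: span_insert)
  have "c \<noteq> 0" using y assms(2) by (auto simp: scale_zero_left)
  have "scale c x = y - a" using y by simp
  then have "scale (inverse c) (scale c x) = scale (inverse c) (y - a)" by simp
  then have x: "x = scale (inverse c) (y - a)" using \<open>c \<noteq> 0\<close> by (simp add: scale_scale scale_one)
  have "y \<in> span (insert y A)" "a \<in> span (insert y A)"
    using span_superset[of "insert y A"] span_mono[of A "insert y A"] y by blast+
  then have "y - a \<in> span (insert y A)" using lin_subspace_diff lin_subspace_span by blast
  then show ?thesis using x lin_subspace_span[of "insert y A"] by (auto simp: lin_subspace_def)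
qed

text \<open>Links independence by coefficients with independence in the closure \<open>span\<close>,
  by solving a linear relation for one of its vectors.\<close>

lemma span_independent_iff:
  assumes B: "finite B"
  shows "(\<forall>c. (\<Sum>b\<in>B. scale (c b) b) = 0 \<longrightarrow> (\<forall>b\<in>B. c b = 0)) \<longleftrightarrow> (\<forall>x\<in>B. x \<notin> span (B - {x}))"
proof (intro iffI allI impI ballI notI)
  fix x assume ind: "\<forall>c. (\<Sum>b\<in>B. scale (c b) b) = 0 \<longrightarrow> (\<forall>b\<in>B. c b = 0)"
    and x: "x \<in> B" "x \<in> span (B - {x})"
  then obtain c where c: "x = (\<Sum>b\<in>B - {x}. scale (c b) b)"
    using span_finite[of "B - {x}"] B by auto
  \<comment> \<open>The coefficient \<open>-1\<close> at \<open>x\<close> turns the expression of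
    \<open>x\<close> by the other vectors into a nontrivial relation.\<close>
  have "(\<Sum>b\<in>B. scale ((c(x := -1)) b) b) =
      scale (- 1) x + (\<Sum>b\<in>B - {x}. scale ((c(x := -1)) b) b)"
    using sum.remove[OF B x(1), of "\<lambda>b. scale ((c(x := -1)) b) b"] by simp
  also have "(\<Sum>b\<in>B - {x}. scale ((c(x := -1)) b) b) = (\<Sum>b\<in>B - {x}. scale (c b) b)"
    by (rule sum.cong) auto
  finally have "(\<Sum>b\<in>B. scale ((c(x := -1)) b) b) = 0" using c by (simp add: scale_minus_one)
  then have "(c(x := -1)) x = 0" using ind x(1) by blast
  then show False by simp
next
  fix c b assume ind: "\<forall>x\<in>B. x \<notin> span (B - {x})"
    and c: "(\<Sum>b\<in>B. scale (c b) b) = 0" and b: "b \<in> B"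
  show "c b = 0"
  proof (rule ccontr)
    assume nz: "c b \<noteq> 0"
    let ?s = "\<Sum>b\<in>B - {b}. scale (c b) b"
    have "scale (c b) b + ?s = 0" using c sum.remove[OF B b, of "\<lambda>b. scale (c b) b"] by simp
    then have "scale (c b) b = - ?s" by (simp add: eq_neg_iff_add_eq_0)
    then have "scale (inverse (c b)) (scale (c b) b) = scale (inverse (c b)) (scale (- 1) ?s)"
      by (simp add: scale_minus_one)
    then have beq: "scale (inverse (c b)) (scale (- 1) ?s) = b"
      using nz by (simp add: scale_scale scale_one)
    have "?s \<in> span (B - {b})" using span_finite[of "B - {b}"] B by auto
    then have "scale (inverse (c b)) (scale (- 1) ?s) \<in> span (B - {b})"
      by (intro lin_subspace_scale lin_subspace_span)
    then show False unfolding beq using ind b by blast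
  qed
qed

lemma finite_basis_iff:
  assumes "lin_subspace scale W"
  shows "finite_basis scale W B \<longleftrightarrow> finite B \<and> (\<forall>x\<in>B. x \<notin> span (B - {x})) \<and> span B = W"
proof (cases "finite B")
    case True
    have "span B = W \<longleftrightarrow> B \<subseteq> W \<and> (\<forall>w\<in>W. \<exists>c. w = (\<Sum>b\<in>B. scale (c b) b))"
      using span_finite[OF True] span_superset[of B] span_least[OF assms, of B] by auto
    then show ?thesis
      unfolding finite_basis_def span_independent_iff[OF True] by (simp only: conj_ac)
qed (simp add: finite_basis_def)

text \<open>The carrier consists of vectors and not of projective points, so the closure of the
  empty set is the zero subspace and ranks are linear dimensions.\<close>

lemma exchange_closure_span:
  assumes "has_lin_dim scale UNIV m"
  shows "exchange_closure UNIV span"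
proof
  show "A \<subseteq> span A" "span A \<subseteq> UNIV" for A using span_superset by auto
  show "A \<subseteq> B \<Longrightarrow> span A \<subseteq> span B" for A B by (rule span_mono)
  show "span (span A) = span A" for A using span_subspace lin_subspace_span by blast
  show "y \<in> span (insert x A) \<Longrightarrow> y \<notin> span A \<Longrightarrow> x \<in> span (insert y A)" for x y A
    by (rule span_exchange)
  show "x \<in> span {p} \<or> (\<exists>a\<in>A. x \<in> span {a, p})" if A: "span A = A" and x: "x \<in> span (insert p A)" for A p x
  proof -
    obtain c a where x: "x = scale c p + a" "a \<in> A" using x A by (auto simp: span_insert)
    have "p \<in> span {a, p}" "a \<in> span {a, p}" using span_superset[of "{a, p}"] by auto
    then have "x \<in> span {a, p}"
      using x lin_subspace_add lin_subspace_scale lin_subspace_span by metis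
    then show ?thesis using x by blast
  qed
  show "\<exists>B. finite B \<and> B \<subseteq> UNIV \<and> span B = UNIV"
    using assms finite_basis_iff[of UNIV] by (auto simp: has_lin_dim_def)
qed

lemma flat_span_iff:
  assumes "has_lin_dim scale UNIV m"
  shows "exchange_closure.flat UNIV span W \<longleftrightarrow> lin_subspace scale W"
  using exchange_closure.flat_def[OF exchange_closure_span[OF assms]] span_subspace lin_subspace_span
  by (metis subset_UNIV)

lemma has_lin_dim_iff_rk:
  assumes "has_lin_dim scale UNIV m"
  shows "has_lin_dim scale W d \<longleftrightarrow> lin_subspace scale W \<and> exchange_closure.rk UNIV span W = d"
proof (cases "lin_subspace scale W")
  case True
  interpret E: exchange_closure UNIV span by (rule exchange_closure_span[OF assms])
  show ?thesis
    using True E.basis_iff_rk[of W d]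
    unfolding has_lin_dim_def finite_basis_iff[OF True] E.basis_def E.indep_def
    by (simp add: flat_span_iff[OF assms])
qed (simp add: has_lin_dim_def)

end

section \<open>Stars and tops in modular lattices\<close>

text \<open>Order, operations and rank are parameters, so that the reversed lattice is an instance
  as well and statements about tops follow from those about stars.\<close>

locale ranked_modular_lattice =
  fixes C :: "'a set" and le :: "'a \<Rightarrow> 'a \<Rightarrow> bool" (infix "\<sqsubseteq>" 50)
    and meet :: "'a \<Rightarrow> 'a \<Rightarrow> 'a" (infixl "\<sqinter>" 70)
    and join :: "'a \<Rightarrow> 'a \<Rightarrow> 'a" (infixl "\<squnion>" 65)
    and rk :: "'a \<Rightarrow> nat" and m :: nat
  assumes le_refl: "x \<in> C \<Longrightarrow> x \<sqsubseteq> x"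
    and le_antisym: "\<lbrakk>x \<in> C; y \<in> C; x \<sqsubseteq> y; y \<sqsubseteq> x\<rbrakk> \<Longrightarrow> x = y"
    and le_trans: "\<lbrakk>x \<in> C; y \<in> C; z \<in> C; x \<sqsubseteq> y; y \<sqsubseteq> z\<rbrakk> \<Longrightarrow> x \<sqsubseteq> z"
    and meet_closed: "\<lbrakk>x \<in> C; y \<in> C\<rbrakk> \<Longrightarrow> x \<sqinter> y \<in> C"
    and meet_lower: "\<lbrakk>x \<in> C; y \<in> C\<rbrakk> \<Longrightarrow> x \<sqinter> y \<sqsubseteq> x \<and> x \<sqinter> y \<sqsubseteq> y"
    and meet_greatest: "\<lbrakk>x \<in> C; y \<in> C; z \<in> C; z \<sqsubseteq> x; z \<sqsubseteq> y\<rbrakk> \<Longrightarrow> z \<sqsubseteq> x \<sqinter> y"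
    and join_closed: "\<lbrakk>x \<in> C; y \<in> C\<rbrakk> \<Longrightarrow> x \<squnion> y \<in> C"
    and join_upper: "\<lbrakk>x \<in> C; y \<in> C\<rbrakk> \<Longrightarrow> x \<sqsubseteq> x \<squnion> y \<and> y \<sqsubseteq> x \<squnion> y"
    and join_least: "\<lbrakk>x \<in> C; y \<in> C; z \<in> C; x \<sqsubseteq> z; y \<sqsubseteq> z\<rbrakk> \<Longrightarrow> x \<squnion> y \<sqsubseteq> z"
    and rk_mono: "\<lbrakk>x \<in> C; y \<in> C; x \<sqsubseteq> y\<rbrakk> \<Longrightarrow> rk x \<le> rk y"
    and rk_eq: "\<lbrakk>x \<in> C; y \<in> C; x \<sqsubseteq> y; rk x = rk y\<rbrakk> \<Longrightarrow> x = y"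
    and rk_modular: "\<lbrakk>x \<in> C; y \<in> C\<rbrakk> \<Longrightarrow> rk (x \<sqinter> y) + rk (x \<squnion> y) = rk x + rk y"
    and bot_ex: "\<exists>b\<in>C. rk b = 0 \<and> (\<forall>x\<in>C. b \<sqsubseteq> x)"
    and top_ex: "\<exists>t\<in>C. rk t = m \<and> (\<forall>x\<in>C. x \<sqsubseteq> t)"
    and complement: "\<lbrakk>a \<in> C; x \<in> C; b \<in> C; a \<sqsubseteq> x; x \<sqsubseteq> b\<rbrakk>
       \<Longrightarrow> \<exists>y\<in>C. x \<sqinter> y = a \<and> x \<squnion> y = b"
    and atom: "\<lbrakk>a \<in> C; b \<in> C; a \<sqsubseteq> b; rk a < rk b\<rbrakk>
       \<Longrightarrow> \<exists>c\<in>C. a \<sqsubseteq> c \<and> c \<sqsubseteq> b \<and> rk c = Suc (rk a)"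
begin

lemma rk_le: "x \<in> C \<Longrightarrow> rk x \<le> m"
  using top_ex rk_mono by metis

text \<open>The complement, between \<open>a\<close> and \<open>b\<close>, of an element covering
  \<open>a\<close> is covered by \<open>b\<close>. This is what the dual lattice needs for its axiom
  \<open>atom\<close>.\<close>

lemma coatom:
  assumes "a \<in> C" "b \<in> C" "a \<sqsubseteq> b" "rk a < rk b"
  shows "\<exists>c\<in>C. a \<sqsubseteq> c \<and> c \<sqsubseteq> b \<and> Suc (rk c) = rk b"
proof -
  obtain x where x: "x \<in> C" "a \<sqsubseteq> x" "x \<sqsubseteq> b" "rk x = Suc (rk a)" using atom assms by metis
  obtain y where y: "y \<in> C" "x \<sqinter> y = a" "x \<squnion> y = b"
    using complement[of a x b] assms x by blast
  have "Suc (rk y) = rk b" using rk_modular[OF x(1) y(1)] y x by simp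
  then show ?thesis using y meet_lower[OF x(1) y(1)] join_upper[OF x(1) y(1)] by metis
qed

text \<open>The dual rank is the corank; truncated subtraction is harmless because
  \<open>rk_le\<close> bounds all ranks by \<open>m\<close>.\<close>

lemma dual: "ranked_modular_lattice C (\<lambda>x y. y \<sqsubseteq> x) (\<squnion>) (\<sqinter>) (\<lambda>x. m - rk x) m"
proof
  show "x = y" if "x \<in> C" "y \<in> C" "y \<sqsubseteq> x" "m - rk x = m - rk y" for x y
    using rk_eq[of y x] rk_le that by (metis diff_diff_cancel)
  show "m - rk (x \<squnion> y) + (m - rk (x \<sqinter> y)) = m - rk x + (m - rk y)" if "x \<in> C" "y \<in> C" for x y
    using rk_modular[OF that] rk_le[of x] rk_le[of y] rk_le[of "x \<sqinter> y"] rk_le[of "x \<squnion> y"]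
      meet_closed join_closed that by auto
  show "\<exists>b\<in>C. m - rk b = 0 \<and> (\<forall>x\<in>C. x \<sqsubseteq> b)" using top_ex by auto
  show "\<exists>t\<in>C. m - rk t = m \<and> (\<forall>x\<in>C. t \<sqsubseteq> x)" using bot_ex by (metis diff_zero)
  show "\<exists>y\<in>C. x \<squnion> y = a \<and> x \<sqinter> y = b" if "a \<in> C" "x \<in> C" "b \<in> C" "x \<sqsubseteq> a" "b \<sqsubseteq> x" for a x b
    using complement that by blast
  show "\<exists>c\<in>C. c \<sqsubseteq> a \<and> b \<sqsubseteq> c \<and> m - rk c = Suc (m - rk a)"
    if ab: "a \<in> C" "b \<in> C" "b \<sqsubseteq> a" "m - rk a < m - rk b" for a b
  proof -
    have "rk b < rk a" using ab by linarith
    then obtain c where c: "c \<in> C" "b \<sqsubseteq> c" "c \<sqsubseteq> a" "Suc (rk c) = rk a"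
      using coatom[OF ab(2,1,3)] by blast
    then have "m - rk c = Suc (m - rk a)" using rk_le[OF ab(1)] by linarith
    then show ?thesis using c by blast
  qed
  show "x \<sqsubseteq> x" if "x \<in> C" for x using le_refl that .
  show "x = y" if "x \<in> C" "y \<in> C" "y \<sqsubseteq> x" "x \<sqsubseteq> y" for x y using le_antisym that by blast
  show "z \<sqsubseteq> x" if "x \<in> C" "y \<in> C" "z \<in> C" "y \<sqsubseteq> x" "z \<sqsubseteq> y" for x y z
    using le_trans[of z y x] that by blast
  show "m - rk x \<le> m - rk y" if "x \<in> C" "y \<in> C" "y \<sqsubseteq> x" for x y
    using rk_mono[of y x] that by simp
qed (simp_all add: meet_closed meet_lower meet_greatest join_closed join_upper join_least)

lemma other_between:
  assumes C: "a \<in> C" "X \<in> C" "b \<in> C" and le: "a \<sqsubseteq> X" "X \<sqsubseteq> b"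
    and rk: "rk X = Suc (rk a)" "rk b = Suc (rk X)"
  shows "\<exists>Y\<in>C. a \<sqsubseteq> Y \<and> Y \<sqsubseteq> b \<and> rk Y = rk X \<and> Y \<noteq> X \<and> X \<sqinter> Y = a \<and> X \<squnion> Y = b"
proof -
  obtain Y where Y: "Y \<in> C" "X \<sqinter> Y = a" "X \<squnion> Y = b" using complement C le by blast
  have r: "rk Y = rk X" using rk_modular[OF C(2) Y(1)] Y rk by simp
  have "Y \<noteq> X"
  proof
    assume "Y = X"
    then have "X \<sqsubseteq> a" using meet_greatest[of X X X] C le_refl Y by auto
    then show False using rk_mono[OF C(2,1)] rk by simp
  qed
  then show ?thesis using Y r meet_lower[OF C(2) Y(1)] join_upper[OF C(2) Y(1)] by blast
qed

lemma above_two: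
  assumes C: "a \<in> C" "X \<in> C" and le: "a \<sqsubseteq> X" and rk: "rk X = Suc (rk a)" "rk X < m"
  shows "\<exists>Y\<in>C. a \<sqsubseteq> Y \<and> rk Y = rk X \<and> Y \<noteq> X"
proof -
  obtain w where "w \<in> C" "X \<sqsubseteq> w" "rk w = Suc (rk X)" using top_ex atom[of X] C rk by metis
  then show ?thesis using other_between[of a X w] C le rk by blast
qed

lemma meet_rk_above:
  assumes C: "a \<in> C" "X \<in> C" "Y \<in> C" and le: "a \<sqsubseteq> X" "a \<sqsubseteq> Y"
    and rk: "rk X = Suc (rk a)" "rk Y = rk X" and "X \<noteq> Y"
  shows "X \<sqinter> Y = a"
proof -
  have M: "X \<sqinter> Y \<in> C" "X \<sqinter> Y \<sqsubseteq> X" "X \<sqinter> Y \<sqsubseteq> Y" "a \<sqsubseteq> X \<sqinter> Y"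
    using meet_closed meet_lower meet_greatest C le by auto
  have "rk (X \<sqinter> Y) \<noteq> rk X" using rk_eq[of "X \<sqinter> Y"] M C rk \<open>X \<noteq> Y\<close> by metis
  then have "rk (X \<sqinter> Y) = rk a"
    using rk_mono[OF M(1) C(2) M(2)] rk_mono[OF C(1) M(1,4)] rk by simp
  then show ?thesis using rk_eq[OF C(1) M(1,4)] by simp
qed

text \<open>The source of the transfer axioms. \<open>X \<squnion> Z\<close> has rank one more than
  \<open>X\<close>, so the interval from \<open>a'\<close> to it has length two and contains a
  second element besides \<open>X\<close>.\<close>

lemma above_transfer:
  assumes C: "a \<in> C" "a' \<in> C" "X \<in> C" "Z \<in> C" and le: "a \<sqsubseteq> X" "a' \<sqsubseteq> X" "a \<sqsubseteq> Z"
    and rk: "rk X = Suc (rk a)" "rk a' = rk a" "rk Z = rk X" and ZX: "Z \<noteq> X"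
  shows "\<exists>b\<in>C. rk b = Suc (rk X) \<and> Z \<sqsubseteq> b \<and> X \<sqsubseteq> b \<and>
    (\<exists>Y\<in>C. rk Y = rk X \<and> a' \<sqsubseteq> Y \<and> Y \<sqsubseteq> b \<and> Y \<noteq> X)"
proof -
  let ?b = "X \<squnion> Z"
  have "X \<sqinter> Z = a" using meet_rk_above C le rk ZX by metis
  then have b: "rk ?b = Suc (rk X)" "?b \<in> C" "X \<sqsubseteq> ?b" "Z \<sqsubseteq> ?b"
    using rk_modular[OF C(3,4)] rk join_closed join_upper C by auto
  show ?thesis using other_between[OF C(2,3) b(2) le(2) b(3)] rk b by auto
qed

text \<open>An atom over \<open>a\<close> inside a complement of \<open>b\<close> above
  \<open>a\<close> is not below \<open>b\<close>.\<close>

lemma escape_above: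
  assumes C: "a \<in> C" "b \<in> C" and le: "a \<sqsubseteq> b" and rk: "rk b < m"
  shows "\<exists>Z\<in>C. a \<sqsubseteq> Z \<and> rk Z = Suc (rk a) \<and> \<not> Z \<sqsubseteq> b"
proof -
  obtain t where t: "t \<in> C" "rk t = m" "\<And>x. x \<in> C \<Longrightarrow> x \<sqsubseteq> t" using top_ex by blast
  obtain c where c: "c \<in> C" "b \<sqinter> c = a" "b \<squnion> c = t" using complement[of a b t] C le t by blast
  have ac: "a \<sqsubseteq> c" using meet_lower[OF C(2) c(1)] c by simp
  have "rk a < rk c" using rk_modular[OF C(2) c(1)] c t rk by simp
  then obtain Z where Z: "Z \<in> C" "a \<sqsubseteq> Z" "Z \<sqsubseteq> c" "rk Z = Suc (rk a)"
    using atom[OF C(1) c(1) ac] by blast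
  have "\<not> Z \<sqsubseteq> b"
  proof
    assume "Z \<sqsubseteq> b"
    then have "Z \<sqsubseteq> a" using meet_greatest[OF C(2) c(1) Z(1)] Z c by simp
    then show False using rk_mono[OF Z(1) C(1)] Z by simp
  qed
  then show ?thesis using Z by blast
qed

text \<open>Take a hyperplane \<open>a\<close> of \<open>Y\<close> through
  \<open>X \<sqinter> Y\<close> and two elements \<open>v1\<close>, \<open>v2\<close> covering
  \<open>X \<sqinter> Y\<close> below \<open>X\<close>. Since \<open>a\<close> meets
  \<open>X\<close> exactly in \<open>X \<sqinter> Y\<close>, the joins of \<open>a\<close> with
  \<open>v1\<close> and with \<open>v2\<close> have rank \<open>i\<close>, and each meets
  \<open>X\<close> in more than \<open>Y\<close> does. They differ, because otherwise the join of
  \<open>a\<close> with \<open>w = v1 \<squnion> v2\<close> would be too small.\<close>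

lemma closer_above:
  assumes C: "X \<in> C" "Y \<in> C" and rk: "rk X = i" "rk Y = i" and far: "Suc (rk (X \<sqinter> Y)) < i"
  shows "\<exists>a\<in>C. Suc (rk a) = i \<and> a \<sqsubseteq> Y \<and>
    (\<exists>Y1\<in>C. \<exists>Y2\<in>C. Y1 \<noteq> Y2 \<and> a \<sqsubseteq> Y1 \<and> a \<sqsubseteq> Y2 \<and> rk Y1 = i \<and> rk Y2 = i \<and>
      rk (X \<sqinter> Y) < rk (X \<sqinter> Y1) \<and> rk (X \<sqinter> Y) < rk (X \<sqinter> Y2))"
proof -
  let ?u = "X \<sqinter> Y"
  have u: "?u \<in> C" "?u \<sqsubseteq> X" "?u \<sqsubseteq> Y" using meet_closed meet_lower C by auto
  obtain a where a: "a \<in> C" "?u \<sqsubseteq> a" "a \<sqsubseteq> Y" "Suc (rk a) = i"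
    using coatom[OF u(1) C(2) u(3)] rk far by auto
  obtain v1 where v1: "v1 \<in> C" "?u \<sqsubseteq> v1" "v1 \<sqsubseteq> X" "rk v1 = Suc (rk ?u)"
    using atom[OF u(1) C(1) u(2)] rk far by auto
  obtain w where w: "w \<in> C" "v1 \<sqsubseteq> w" "w \<sqsubseteq> X" "rk w = Suc (rk v1)"
    using atom[OF v1(1) C(1) v1(3)] rk far v1 by auto
  obtain v2 where v2: "v2 \<in> C" "?u \<sqsubseteq> v2" "v2 \<sqsubseteq> w" "rk v2 = rk v1" "v1 \<squnion> v2 = w"
    using other_between[OF u(1) v1(1) w(1) v1(2) w(2) v1(4) w(4)] by blast
  have join_a: "rk (a \<squnion> v) + rk ?u = rk a + rk v"
    if v: "v \<in> C" "?u \<sqsubseteq> v" "v \<sqsubseteq> X" for v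
  proof -
    have av: "a \<sqinter> v \<in> C" "a \<sqinter> v \<sqsubseteq> a" "a \<sqinter> v \<sqsubseteq> v" using meet_closed meet_lower a v by auto
    have "a \<sqinter> v \<sqsubseteq> ?u"
      using meet_greatest[OF C av(1)] le_trans[OF av(1) a(1) C(2) av(2) a(3)]
        le_trans[OF av(1) v(1) C(1) av(3) v(3)] by blast
    moreover have "?u \<sqsubseteq> a \<sqinter> v" using meet_greatest a u v by blast
    ultimately have "a \<sqinter> v = ?u" using le_antisym av u by blast
    then show ?thesis using rk_modular[OF a(1) v(1)] by simp
  qed
  have v2X: "v2 \<sqsubseteq> X" using le_trans v2 w C by blast
  have Y12: "a \<squnion> v \<in> C" "a \<sqsubseteq> a \<squnion> v" "v \<sqsubseteq> a \<squnion> v" if "v \<in> C" for v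
    using join_closed join_upper a that by auto
  have r1: "rk (a \<squnion> v1) = i" using join_a[OF v1(1,2,3)] v1 a by simp
  have r2: "rk (a \<squnion> v2) = i" using join_a[OF v2(1,2) v2X] v2 v1 a by simp
  have closer: "rk ?u < rk (X \<sqinter> (a \<squnion> v))" if v: "v \<in> C" "v \<sqsubseteq> X" "rk v = Suc (rk ?u)" for v
    using rk_mono[OF v(1) meet_closed[OF C(1) Y12(1)[OF v(1)]]]
      meet_greatest[OF C(1) Y12(1)[OF v(1)] v(1,2) Y12(3)[OF v(1)]] v(3) by simp
  have "a \<squnion> v1 \<noteq> a \<squnion> v2"
  proof
    assume eq: "a \<squnion> v1 = a \<squnion> v2"
    have "w \<sqsubseteq> a \<squnion> v1"
      using join_least[OF v1(1) v2(1) Y12(1)[OF v1(1)] Y12(3)[OF v1(1)]]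
        Y12(3)[OF v2(1)] eq v2(5) by simp
    then have "a \<squnion> w \<sqsubseteq> a \<squnion> v1"
      using join_least[OF a(1) w(1)] Y12 v1 by blast
    then have "rk (a \<squnion> w) \<le> i" using rk_mono Y12 v1 w r1 by metis
    moreover have "?u \<sqsubseteq> w" using le_trans[OF u(1) v1(1) w(1) v1(2) w(2)] .
    ultimately show False using join_a[OF w(1) _ w(3)] w v1 a by simp
  qed
  moreover have "rk ?u < rk (X \<sqinter> (a \<squnion> v1))" "rk ?u < rk (X \<sqinter> (a \<squnion> v2))"
    using closer v1 v2X v2 by auto
  ultimately show ?thesis using a r1 r2 Y12 v1 v2 by blast
qed

end

text \<open>\<open>S\<close> and \<open>T\<close> are the stars and the tops of a Grassmann graph. The axioms are symmetric in the two
  families, so every result on stars has a version for tops.\<close>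

locale two_clique_graph =
  fixes G :: "'a set" and adj :: "'a \<Rightarrow> 'a \<Rightarrow> bool" and S T :: "'a set set"
    and d :: "'a \<Rightarrow> 'a \<Rightarrow> nat"
  assumes nonempty: "G \<noteq> {}"
    and S_sub: "A \<in> S \<Longrightarrow> A \<subseteq> G"
    and T_sub: "B \<in> T \<Longrightarrow> B \<subseteq> G"
    and S_adj: "\<lbrakk>A \<in> S; X \<in> A; Y \<in> A; X \<noteq> Y\<rbrakk> \<Longrightarrow> adj X Y"
    and T_adj: "\<lbrakk>B \<in> T; X \<in> B; Y \<in> B; X \<noteq> Y\<rbrakk> \<Longrightarrow> adj X Y"
    and adj_sym: "adj X Y \<Longrightarrow> adj Y X"
    and S_vertex: "X \<in> G \<Longrightarrow> \<exists>A\<in>S. X \<in> A"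
    and T_vertex: "X \<in> G \<Longrightarrow> \<exists>B\<in>T. X \<in> B"
    and S_two: "A \<in> S \<Longrightarrow> \<exists>X\<in>A. \<exists>Y\<in>A. X \<noteq> Y"
    and T_two: "B \<in> T \<Longrightarrow> \<exists>X\<in>B. \<exists>Y\<in>B. X \<noteq> Y"
    and S_edge: "\<lbrakk>X \<in> G; Y \<in> G; adj X Y\<rbrakk> \<Longrightarrow> \<exists>A\<in>S. X \<in> A \<and> Y \<in> A"
    and T_edge: "\<lbrakk>X \<in> G; Y \<in> G; adj X Y\<rbrakk> \<Longrightarrow> \<exists>B\<in>T. X \<in> B \<and> Y \<in> B"
    and cross: "\<lbrakk>A \<in> S; B \<in> T; X \<in> A \<inter> B; Y \<in> A \<inter> B; X \<noteq> Y\<rbrakk>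
       \<Longrightarrow> \<exists>Z\<in>A. \<exists>W\<in>B. Z \<noteq> W \<and> \<not> adj Z W"
    and S_transfer: "\<lbrakk>A \<in> S; A' \<in> S; X \<in> A \<inter> A'; Z \<in> A; Z \<noteq> X\<rbrakk>
       \<Longrightarrow> \<exists>B\<in>T. Z \<in> B \<and> X \<in> B \<and> (\<exists>Y\<in>A' \<inter> B. Y \<noteq> X)"
    and T_transfer: "\<lbrakk>B \<in> T; B' \<in> T; X \<in> B \<inter> B'; Z \<in> B; Z \<noteq> X\<rbrakk>
       \<Longrightarrow> \<exists>A\<in>S. Z \<in> A \<and> X \<in> A \<and> (\<exists>Y\<in>B' \<inter> A. Y \<noteq> X)"
    and S_closer: "\<lbrakk>X \<in> G; Y \<in> G; X \<noteq> Y; \<not> adj X Y\<rbrakk> \<Longrightarrow> \<exists>A\<in>S. Y \<in> A \<and>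
       (\<exists>Y1\<in>A. \<exists>Y2\<in>A. Y1 \<noteq> Y2 \<and> d X Y1 < d X Y \<and> d X Y2 < d X Y)"
    and T_closer: "\<lbrakk>X \<in> G; Y \<in> G; X \<noteq> Y; \<not> adj X Y\<rbrakk> \<Longrightarrow> \<exists>B\<in>T. Y \<in> B \<and>
       (\<exists>Y1\<in>B. \<exists>Y2\<in>B. Y1 \<noteq> Y2 \<and> d X Y1 < d X Y \<and> d X Y2 < d X Y)"

section \<open>Stars and tops in one level of a ranked modular lattice\<close>

context ranked_modular_lattice
begin

definition star :: "nat \<Rightarrow> 'a \<Rightarrow> 'a set" where
  "star i a = {x \<in> C. rk x = i \<and> a \<sqsubseteq> x}"

definition costar :: "nat \<Rightarrow> 'a \<Rightarrow> 'a set" where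
  "costar i b = {x \<in> C. rk x = i \<and> x \<sqsubseteq> b}"

definition level_adj :: "nat \<Rightarrow> 'a \<Rightarrow> 'a \<Rightarrow> bool" where
  "level_adj i X Y \<longleftrightarrow> X \<in> C \<and> Y \<in> C \<and> rk X = i \<and> rk Y = i \<and> rk (X \<sqinter> Y) = i - 1"

text \<open>\<open>Z\<close> covers \<open>a\<close> and is not below \<open>b\<close>, so
  \<open>Z \<sqinter> b = a\<close>, and hence \<open>Z \<sqinter> W\<close> is below
  \<open>a\<close>. If it had the rank of \<open>a\<close> it would be \<open>a\<close>, which is
  not below \<open>W\<close>.\<close>

lemma cross_nonadjacent:
  assumes C: "a \<in> C" "b \<in> C" "Z \<in> C" "W \<in> C" and rk: "rk Z = Suc (rk a)"
    and Z: "a \<sqsubseteq> Z" "\<not> Z \<sqsubseteq> b" and W: "W \<sqsubseteq> b" "\<not> a \<sqsubseteq> W" and ab: "a \<sqsubseteq> b"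
  shows "Z \<noteq> W \<and> rk (Z \<sqinter> W) \<noteq> rk a"
proof (intro conjI notI)
  show False if "Z = W" using that Z W by blast
  assume eq: "rk (Z \<sqinter> W) = rk a"
  have ZW: "Z \<sqinter> W \<in> C" "Z \<sqinter> W \<sqsubseteq> Z" "Z \<sqinter> W \<sqsubseteq> W" using meet_closed meet_lower C by auto
  have Zb: "Z \<sqinter> b \<in> C" "Z \<sqinter> b \<sqsubseteq> Z" "Z \<sqinter> b \<sqsubseteq> b" using meet_closed meet_lower C by auto
  have aZb: "a \<sqsubseteq> Z \<sqinter> b" using meet_greatest C Z ab by blast
  have "rk (Z \<sqinter> b) \<noteq> rk Z" using rk_eq[OF Zb(1) C(3) Zb(2)] Zb(3) Z by metis
  then have "rk (Z \<sqinter> b) = rk a"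
    using rk_mono[OF Zb(1) C(3) Zb(2)] rk_mono[OF C(1) Zb(1) aZb] rk by simp
  then have "Z \<sqinter> b = a" using rk_eq[OF C(1) Zb(1) aZb] by simp
  moreover have "Z \<sqinter> W \<sqsubseteq> Z \<sqinter> b"
    using meet_greatest[OF C(3,2) ZW(1,2)] le_trans[OF ZW(1) C(4,2) ZW(3) W(1)] by blast
  ultimately have "Z \<sqinter> W = a" using rk_eq[OF ZW(1) C(1)] eq by simp
  then show False using ZW W by simp
qed

text \<open>Statements about tops come from the star lemmas in the dual lattice \<open>D\<close>. In
  \<open>cross\<close> the bounds on \<open>i\<close> ensure that the centre of a star is not the
  bottom element and that the upper bound of a top is not the top element. The distance is
  \<open>i\<close> minus the rank of the meet.\<close>

lemma two_clique_graph_level: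
  assumes i: "1 < i" "Suc i < m"
  shows "two_clique_graph {x \<in> C. rk x = i} (level_adj i)
    (star i ` {a \<in> C. rk a = i - 1}) (costar i ` {b \<in> C. rk b = Suc i}) (\<lambda>x y. i - rk (x \<sqinter> y))"
    (is "two_clique_graph ?G ?adj ?S ?T ?d")
proof -
  interpret D: ranked_modular_lattice C "\<lambda>x y. y \<sqsubseteq> x" "(\<squnion>)" "(\<sqinter>)" "\<lambda>x. m - rk x" m
    by (rule dual)
  have meet_comm: "x \<sqinter> y = y \<sqinter> x" if "x \<in> C" "y \<in> C" for x y
    using le_antisym[of "x \<sqinter> y" "y \<sqinter> x"] meet_greatest[of y x "x \<sqinter> y"]
      meet_greatest[of x y "y \<sqinter> x"] meet_closed meet_lower that by simp
  have join_meet: "rk (x \<squnion> y) + rk (x \<sqinter> y) = i + i" if "x \<in> C" "y \<in> C" "rk x = i" "rk y = i" for x y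
    using rk_modular[OF that(1,2)] that by simp
  have codim: "rk x = i" if "x \<in> C" "m - rk x = m - i" for x
    using rk_le[OF that(1)] that(2) i by linarith
  obtain t where t: "t \<in> C" "rk t = m" "\<And>x. x \<in> C \<Longrightarrow> x \<sqsubseteq> t" using top_ex by blast
  obtain z where z: "z \<in> C" "rk z = 0" "\<And>x. x \<in> C \<Longrightarrow> z \<sqsubseteq> x" using bot_ex by blast
  have starE: "\<exists>a\<in>C. Suc (rk a) = i \<and> A = {x \<in> C. rk x = i \<and> a \<sqsubseteq> x}" if "A \<in> ?S" for A
  proof -
    obtain a where "a \<in> C" "rk a = i - 1" "A = star i a" using \<open>A \<in> ?S\<close> by blast
    then show ?thesis using i by (intro bexI[of _ a]) (simp_all add: star_def)
  qed
  have starI: "{x \<in> C. rk x = i \<and> a \<sqsubseteq> x} \<in> ?S" if "a \<in> C" "Suc (rk a) = i" for a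
    using that i by (auto simp: star_def)
  have costarE: "\<exists>b\<in>C. rk b = Suc i \<and> B = {x \<in> C. rk x = i \<and> x \<sqsubseteq> b}" if "B \<in> ?T" for B
    using that by (auto simp: costar_def)
  have costarI: "{x \<in> C. rk x = i \<and> x \<sqsubseteq> b} \<in> ?T" if "b \<in> C" "rk b = Suc i" for b
    using that by (auto simp: costar_def)
  show ?thesis
  proof
    have "\<exists>x\<in>C. rk x = j" if "j \<le> m" for j
      using that
    proof (induction j)
      case (Suc j)
      then obtain x where x: "x \<in> C" "rk x = j" by auto
      then show ?case using atom[OF x(1) t(1) t(3)] t Suc.prems by auto
    qed (use z in blast)
    from this[of i] show "?G \<noteq> {}" using i by auto
  next
    fix A assume A: "A \<in> ?S"
    from starE[OF this] obtain a where
      a: "a \<in> C" "Suc (rk a) = i" and Adef: "A = {x \<in> C. rk x = i \<and> a \<sqsubseteq> x}" by blast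
    show "A \<subseteq> ?G" by (auto simp: Adef)
    show "?adj X Y" if XY: "X \<in> A" "Y \<in> A" "X \<noteq> Y" for X Y
    proof -
      have XYC: "X \<in> C" "rk X = i" "a \<sqsubseteq> X" "Y \<in> C" "rk Y = i" "a \<sqsubseteq> Y"
        using XY by (auto simp: Adef)
      have "X \<sqinter> Y = a" using meet_rk_above[OF a(1) XYC(1,4,3,6)] XYC a XY(3) by simp
      then show ?thesis using XYC a(2) unfolding level_adj_def by simp
    qed
    obtain X where X: "X \<in> C" "a \<sqsubseteq> X" "rk X = i"
      using atom[OF a(1) t(1) t(3)] a t i by auto
    then show "\<exists>X\<in>A. \<exists>Y\<in>A. X \<noteq> Y"
      using above_two[OF a(1) X(1,2)] a(2) i unfolding Adef by auto
    show "\<exists>B\<in>?T. Z \<in> B \<and> X \<in> B \<and> (\<exists>Y\<in>A' \<inter> B. Y \<noteq> X)"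
      if A': "A' \<in> ?S" and X: "X \<in> A \<inter> A'" and Z: "Z \<in> A" "Z \<noteq> X" for A' X Z
    proof -
      from starE[OF A'] obtain a' where
        a': "a' \<in> C" "Suc (rk a') = i" and A'def: "A' = {x \<in> C. rk x = i \<and> a' \<sqsubseteq> x}" by blast
      have XZ: "X \<in> C" "rk X = i" "a \<sqsubseteq> X" "a' \<sqsubseteq> X" "Z \<in> C" "rk Z = i" "a \<sqsubseteq> Z"
        using X Z by (auto simp: Adef A'def)
      obtain b Y where b: "b \<in> C" "rk b = Suc i" "Z \<sqsubseteq> b" "X \<sqsubseteq> b"
        and Y: "Y \<in> C" "rk Y = i" "a' \<sqsubseteq> Y" "Y \<sqsubseteq> b" "Y \<noteq> X"
        using above_transfer[OF a(1) a'(1) XZ(1,5,3,4,7)] a a' XZ Z(2) by auto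
      show ?thesis
        by (rule bexI[OF _ costarI[OF b(1,2)]]) (use b Y XZ in \<open>auto simp: A'def\<close>)
    qed
    show "\<exists>Z\<in>A. \<exists>W\<in>B. Z \<noteq> W \<and> \<not> ?adj Z W"
      if B: "B \<in> ?T" and X: "X \<in> A \<inter> B" and Y: "Y \<in> A \<inter> B" and "X \<noteq> Y" for B X Y
    proof -
      from costarE[OF B] obtain b where
        b: "b \<in> C" "rk b = Suc i" and Bdef: "B = {x \<in> C. rk x = i \<and> x \<sqsubseteq> b}" by blast
      have ab: "a \<sqsubseteq> b" using le_trans[of a X b] a b X by (auto simp: Adef Bdef)
      \<comment> \<open>\<open>Z\<close> is a vertex of the star outside the top; \<open>W\<close>,
        found by the same lemma in the dual lattice, is a vertex of the top outside the
        star.\<close>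
      obtain Z where Z: "Z \<in> C" "a \<sqsubseteq> Z" "rk Z = i" "\<not> Z \<sqsubseteq> b"
        using escape_above[OF a(1) b(1) ab] a b i by auto
      obtain W where W: "W \<in> C" "W \<sqsubseteq> b" "m - rk W = Suc (m - rk b)" "\<not> a \<sqsubseteq> W"
        using D.escape_above[OF b(1) a(1) ab] a b i by auto
      have "rk W = i" using W(3) b i rk_le[OF W(1)] by linarith
      moreover have "Z \<noteq> W \<and> \<not> ?adj Z W"
        using cross_nonadjacent[OF a(1) b(1) Z(1) W(1) _ Z(2,4) W(2,4) ab] a Z
        unfolding level_adj_def by auto
      ultimately show ?thesis using Z W by (auto simp: Adef Bdef)
    qed
  next
    fix B assume B: "B \<in> ?T"
    from costarE[OF this] obtain b where
      b: "b \<in> C" "rk b = Suc i" and Bdef: "B = {x \<in> C. rk x = i \<and> x \<sqsubseteq> b}" by blast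
    have sb: "m - i = Suc (m - rk b)" using b i by linarith
    show "B \<subseteq> ?G" by (auto simp: Bdef)
    show "?adj X Y" if XY: "X \<in> B" "Y \<in> B" "X \<noteq> Y" for X Y
    proof -
      have XYC: "X \<in> C" "rk X = i" "X \<sqsubseteq> b" "Y \<in> C" "rk Y = i" "Y \<sqsubseteq> b"
        using XY by (auto simp: Bdef)
      have "X \<squnion> Y = b" using D.meet_rk_above[OF b(1) XYC(1,4,3,6)] XYC sb XY(3) by simp
      then show ?thesis using join_meet[OF XYC(1,4,2,5)] XYC b(2) unfolding level_adj_def by simp
    qed
    obtain X where X: "X \<in> C" "X \<sqsubseteq> b" "rk X = i"
      using coatom[OF z(1) b(1) z(3)] b z by auto
    have "m - rk X = Suc (m - rk b)" "m - rk X < m" using X sb i by linarith+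
    then obtain Y where Y: "Y \<in> C" "Y \<sqsubseteq> b" "m - rk Y = m - rk X" "Y \<noteq> X"
      using D.above_two[OF b(1) X(1,2)] by blast
    show "\<exists>X\<in>B. \<exists>Y\<in>B. X \<noteq> Y"
      using X Y codim[OF Y(1)] unfolding Bdef by auto
    show "\<exists>A\<in>?S. Z \<in> A \<and> X \<in> A \<and> (\<exists>Y\<in>B' \<inter> A. Y \<noteq> X)"
      if B': "B' \<in> ?T" and X: "X \<in> B \<inter> B'" and Z: "Z \<in> B" "Z \<noteq> X" for B' X Z
    proof -
      from costarE[OF B'] obtain b' where
        b': "b' \<in> C" "rk b' = Suc i" and B'def: "B' = {x \<in> C. rk x = i \<and> x \<sqsubseteq> b'}" by blast
      have XZ: "X \<in> C" "rk X = i" "X \<sqsubseteq> b" "X \<sqsubseteq> b'" "Z \<in> C" "rk Z = i" "Z \<sqsubseteq> b"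
        using X Z by (auto simp: Bdef B'def)
      obtain a Y where a: "a \<in> C" "m - rk a = Suc (m - i)" "a \<sqsubseteq> Z" "a \<sqsubseteq> X"
        and Y: "Y \<in> C" "m - rk Y = m - i" "Y \<sqsubseteq> b'" "a \<sqsubseteq> Y" "Y \<noteq> X"
        using D.above_transfer[OF b(1) b'(1) XZ(1,5,3,4,7)] sb b b' XZ Z(2) by auto
      have ra: "Suc (rk a) = i" using a(2) i by linarith
      show ?thesis
        by (rule bexI[OF _ starI[OF a(1) ra]])
          (use a Y codim[OF Y(1)] XZ in \<open>auto simp: B'def\<close>)
    qed
  next
    show "?adj Y X" if "?adj X Y" for X Y
      using that meet_comm by (auto simp: level_adj_def)
  next
    fix X assume "X \<in> ?G"
    then have X: "X \<in> C" "rk X = i" by auto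
    obtain a where "a \<in> C" "a \<sqsubseteq> X" "Suc (rk a) = i"
      using coatom[OF z(1) X(1) z(3)] z X i by auto
    then show "\<exists>A\<in>?S. X \<in> A" using bexI[OF _ starI[of a]] X by auto
    obtain b where "b \<in> C" "X \<sqsubseteq> b" "rk b = Suc i"
      using atom[OF X(1) t(1) t(3)] t X i by auto
    then show "\<exists>B\<in>?T. X \<in> B" using bexI[OF _ costarI[of b]] X by auto
    fix Y assume "Y \<in> ?G"
    then have Y: "Y \<in> C" "rk Y = i" by auto
    show "\<exists>A\<in>?S. X \<in> A \<and> Y \<in> A" if "?adj X Y"
      by (rule bexI[OF _ starI[of "X \<sqinter> Y"]])
        (use that X Y i meet_closed meet_lower in \<open>auto simp: level_adj_def\<close>)
    show "\<exists>B\<in>?T. X \<in> B \<and> Y \<in> B" if "?adj X Y"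
      by (rule bexI[OF _ costarI[of "X \<squnion> Y"]])
        (use that X Y i join_closed join_upper join_meet[of X Y] in \<open>auto simp: level_adj_def\<close>)
    assume ne: "X \<noteq> Y" and nadj: "\<not> ?adj X Y"
    let ?u = "X \<sqinter> Y"
    have u: "?u \<in> C" "?u \<sqsubseteq> X" "?u \<sqsubseteq> Y" using meet_closed meet_lower X Y by auto
    have "rk ?u \<noteq> i" using rk_eq[OF u(1)] u X Y ne by metis
    moreover have "rk ?u \<noteq> i - 1" using nadj X Y unfolding level_adj_def by simp
    moreover have "rk ?u \<le> i" using rk_mono[OF u(1) X(1) u(2)] X by simp
    ultimately have far: "Suc (rk ?u) < i" by linarith
    obtain a Y1 Y2 where a: "a \<in> C" "Suc (rk a) = i" "a \<sqsubseteq> Y"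
      and Y12: "Y1 \<in> C" "Y2 \<in> C" "Y1 \<noteq> Y2" "a \<sqsubseteq> Y1" "a \<sqsubseteq> Y2" "rk Y1 = i" "rk Y2 = i"
        "rk ?u < rk (X \<sqinter> Y1)" "rk ?u < rk (X \<sqinter> Y2)"
      using closer_above[OF X(1) Y(1) X(2) Y(2) far] by blast
    have "i - rk (X \<sqinter> Y1) < i - rk ?u" "i - rk (X \<sqinter> Y2) < i - rk ?u"
      using Y12 far by linarith+
    then show "\<exists>A\<in>?S. Y \<in> A \<and> (\<exists>Y1\<in>A. \<exists>Y2\<in>A. Y1 \<noteq> Y2 \<and>
        i - rk (X \<sqinter> Y1) < i - rk ?u \<and> i - rk (X \<sqinter> Y2) < i - rk ?u)"
      by (intro bexI[OF _ starI[OF a(1,2)]] conjI bexI[of _ Y1] bexI[of _ Y2])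
        (use a Y12 Y in auto)
    \<comment> \<open>The dual lemma measures distance by coranks of joins; on a fixed level this
      agrees with the measure by meets, since the two ranks add up to \<open>i + i\<close>.\<close>
    have jm: "rk (X \<squnion> Y) + rk ?u = i + i" using join_meet X Y by blast
    have "rk (X \<squnion> Y) \<le> m" using rk_le join_closed X Y by blast
    then have dfar: "Suc (m - rk (X \<squnion> Y)) < m - i" using jm far by linarith
    obtain b Z1 Z2 where b: "b \<in> C" "Suc (m - rk b) = m - i" "Y \<sqsubseteq> b"
      and Z12: "Z1 \<in> C" "Z2 \<in> C" "Z1 \<noteq> Z2" "Z1 \<sqsubseteq> b" "Z2 \<sqsubseteq> b" "m - rk Z1 = m - i" "m - rk Z2 = m - i"
        "m - rk (X \<squnion> Y) < m - rk (X \<squnion> Z1)" "m - rk (X \<squnion> Y) < m - rk (X \<squnion> Z2)"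
      using D.closer_above[OF X(1) Y(1), of "m - i"] X Y dfar by auto
    have rb: "rk b = Suc i" using b rk_le[OF b(1)] by linarith
    have rZ: "rk Z1 = i" "rk Z2 = i" using codim Z12 by auto
    have "rk (X \<squnion> Z1) < rk (X \<squnion> Y)" "rk (X \<squnion> Z2) < rk (X \<squnion> Y)"
      using Z12(8,9) by linarith+
    then have "rk ?u < rk (X \<sqinter> Z1)" "rk ?u < rk (X \<sqinter> Z2)"
      using jm join_meet[OF X(1) Z12(1) X(2) rZ(1)] join_meet[OF X(1) Z12(2) X(2) rZ(2)]
      by linarith+
    then have "i - rk (X \<sqinter> Z1) < i - rk ?u" "i - rk (X \<sqinter> Z2) < i - rk ?u"
      using far by linarith+
    then show "\<exists>B\<in>?T. Y \<in> B \<and> (\<exists>Y1\<in>B. \<exists>Y2\<in>B. Y1 \<noteq> Y2 \<and>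
        i - rk (X \<sqinter> Y1) < i - rk ?u \<and> i - rk (X \<sqinter> Y2) < i - rk ?u)"
      by (intro bexI[OF _ costarI[OF b(1) rb]] conjI bexI[of _ Z1] bexI[of _ Z2])
        (use b Z12 rZ Y in auto)
  qed
qed

end

lemma (in two_clique_graph) two_clique_graph_swap: "two_clique_graph G adj T S d"
proof
  show "\<exists>Z\<in>A. \<exists>W\<in>B. Z \<noteq> W \<and> \<not> adj Z W"
    if AB: "A \<in> T" "B \<in> S" "X \<in> A \<inter> B" "Y \<in> A \<inter> B" "X \<noteq> Y" for A B X Y
  proof -
    have "\<exists>Z\<in>B. \<exists>W\<in>A. Z \<noteq> W \<and> \<not> adj Z W"
      by (rule cross[OF AB(2,1) _ _ AB(5)]) (use AB in auto)
    then show ?thesis by (metis adj_sym)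
  qed
qed (rule nonempty, (erule S_sub T_sub S_adj T_adj adj_sym S_vertex T_vertex S_two T_two S_edge
      T_edge S_transfer T_transfer S_closer T_closer; assumption)+)

lemma (in exchange_closure) ranked_modular_lattice_flats:
  "ranked_modular_lattice {S. flat S} (\<subseteq>) (\<inter>) join rk (rk E)"
proof
  show "x \<inter> y \<in> {S. flat S}" if "x \<in> {S. flat S}" "y \<in> {S. flat S}" for x y
    using flat_Int that by simp
  show "join x y \<in> {S. flat S}" if "x \<in> {S. flat S}" "y \<in> {S. flat S}" for x y
    using flat_join that by simp
  show "x \<subseteq> join x y \<and> y \<subseteq> join x y" if "x \<in> {S. flat S}" "y \<in> {S. flat S}" for x y
    using join_upper that by simp
  show "join x y \<subseteq> z" if "z \<in> {S. flat S}" "x \<subseteq> z" "y \<subseteq> z" for x y z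
    using join_least that by simp
  show "rk x \<le> rk y" if "x \<in> {S. flat S}" "y \<in> {S. flat S}" "x \<subseteq> y" for x y
    using rk_mono that by simp
  show "x = y" if "x \<in> {S. flat S}" "y \<in> {S. flat S}" "x \<subseteq> y" "rk x = rk y" for x y
    using rk_eq that by simp
  show "rk (x \<inter> y) + rk (join x y) = rk x + rk y" if "x \<in> {S. flat S}" "y \<in> {S. flat S}" for x y
    using rk_modular that by simp
  have "basis (cl {}) {}" by (simp add: basis_def indep_def)
  then have "rk (cl {}) = 0" using rk_basis by fastforce
  moreover have "cl {} \<subseteq> x" if "flat x" for x using flat_least[OF that] by simp
  ultimately show "\<exists>b\<in>{S. flat S}. rk b = 0 \<and> (\<forall>x\<in>{S. flat S}. b \<subseteq> x)"
    using flat_cl[of "{}"] by auto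
  show "\<exists>t\<in>{S. flat S}. rk t = rk E \<and> (\<forall>x\<in>{S. flat S}. x \<subseteq> t)"
    using flat_E by (auto simp: flat_def)
  show "\<exists>y\<in>{S. flat S}. x \<inter> y = a \<and> join x y = b"
    if "a \<in> {S. flat S}" "x \<in> {S. flat S}" "b \<in> {S. flat S}" "a \<subseteq> x" "x \<subseteq> b" for a x b
    using flat_complement[of a x b] that by auto
  show "\<exists>c\<in>{S. flat S}. a \<subseteq> c \<and> c \<subseteq> b \<and> rk c = Suc (rk a)"
    if "a \<in> {S. flat S}" "b \<in> {S. flat S}" "a \<subseteq> b" "rk a < rk b" for a b
    using flat_atom[of a b] that by auto
qed auto

section \<open>Grassmann graphs of vector spaces\<close>

context left_vector_space
begin

lemma two_clique_graph_grassmannian: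
  assumes dim: "has_lin_dim scale UNIV m" and i: "1 < i" "i < m - 1"
  shows "\<exists>S T d. two_clique_graph (grassmannian scale i) (grassmann_adj scale i) S T d"
proof -
  interpret E: exchange_closure UNIV span by (rule exchange_closure_span[OF dim])
  have rkU: "E.rk UNIV = m" using has_lin_dim_iff_rk[OF dim, of UNIV m] dim by simp
  interpret R: ranked_modular_lattice "{S. E.flat S}" "(\<subseteq>)" "(\<inter>)" E.join E.rk m
    using E.ranked_modular_lattice_flats rkU by simp
  have G: "grassmannian scale i = {x \<in> {S. E.flat S}. E.rk x = i}"
    unfolding grassmannian_def has_lin_dim_iff_rk[OF dim] flat_span_iff[OF dim] by simp
  have "grassmann_adj scale i X Y \<longleftrightarrow> R.level_adj i X Y" for X Y
    unfolding grassmann_adj_def R.level_adj_def G has_lin_dim_iff_rk[OF dim, of "X \<inter> Y"]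
      flat_span_iff[OF dim, symmetric]
    using E.flat_Int[of X Y] by auto
  then have adj: "grassmann_adj scale i = R.level_adj i" by blast
  show ?thesis using R.two_clique_graph_level[of i] i unfolding G adj by fastforce
qed

end

section \<open>Ranks of singular subspaces\<close>

lemma (in weak_polar) point_subspace_perp:
  assumes "A \<subseteq> P" shows "point_subspace P L {y \<in> P. \<forall>x\<in>A. perp L x y}"
  unfolding point_subspace_def
proof (intro conjI ballI impI subsetI)
  fix p q l y
  assume p: "p \<in> {y \<in> P. \<forall>x\<in>A. perp L x y}" and q: "q \<in> {y \<in> P. \<forall>x\<in>A. perp L x y}"
    and ne: "p \<noteq> q" and l: "l \<in> L" "p \<in> l \<and> q \<in> l" and y: "y \<in> l"
  have "perp L x y" if "x \<in> A" for x
    using perp_all[of x l p q y] p q ne l y that assms by auto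
  then show "y \<in> {y \<in> P. \<forall>x\<in>A. perp L x y}" using line_sub l y by blast
qed auto

lemma (in weak_polar) point_subspace_carrier: "point_subspace P L P"
  using line_sub by (auto simp: point_subspace_def)

text \<open>\<open>maximal_above\<close> carries the chain condition of a polar space, and
  \<open>point_on_line\<close> makes \<open>perp\<close> and collinearity agree on points.\<close>

locale ranked_polar = weak_polar +
  fixes n :: nat
  assumes point_on_line: "p \<in> P \<Longrightarrow> \<exists>l\<in>L. p \<in> l"
    and maximal_above: "singular_subspace P L S \<Longrightarrow> \<exists>M. maximal_singular P L M \<and> S \<subseteq> M"
    and rank: "has_rank P L n"
begin

abbreviation "singular \<equiv> singular_subspace P L"
abbreviation "pspan \<equiv> point_span P L"

lemma collinear_iff_perp: "p \<in> P \<Longrightarrow> collinear_points L p q \<longleftrightarrow> perp L p q"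
  using point_on_line by (auto simp: perp_def collinear_points_def)

lemma singular_iff: "singular S \<longleftrightarrow> point_subspace P L S \<and> (\<forall>p\<in>S. \<forall>q\<in>S. perp L p q)"
proof (cases "point_subspace P L S")
  case True
  then have "S \<subseteq> P" by (simp add: point_subspace_def)
  then have "collinear_points L p q \<longleftrightarrow> perp L p q" if "p \<in> S" for p q
    using collinear_iff_perp that by blast
  then show ?thesis using True by (simp add: singular_subspace_def)
qed (simp add: singular_subspace_def)

lemma singular_sub: "singular S \<Longrightarrow> S \<subseteq> P"
  by (simp add: singular_subspace_def point_subspace_def)

lemma pspan_superset: "X \<subseteq> pspan X"
  by (auto simp: point_span_def)

lemma pspan_least: "point_subspace P L T \<Longrightarrow> X \<subseteq> T \<Longrightarrow> pspan X \<subseteq> T"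
  by (auto simp: point_span_def)

lemma pspan_in: "X \<subseteq> P \<Longrightarrow> pspan X \<subseteq> P"
  using pspan_least point_subspace_carrier .

lemma point_subspace_pspan:
  assumes "X \<subseteq> P" shows "point_subspace P L (pspan X)"
  unfolding point_subspace_def
proof (intro conjI ballI impI)
  fix p q l assume *: "p \<in> pspan X" "q \<in> pspan X" "p \<noteq> q" "l \<in> L" "p \<in> l \<and> q \<in> l"
  have "l \<subseteq> T" if "point_subspace P L T" "X \<subseteq> T" for T
  proof -
    have "p \<in> T" "q \<in> T" using * that pspan_least by blast+
    then show ?thesis using that * unfolding point_subspace_def by blast
  qed
  then show "l \<subseteq> pspan X" unfolding point_span_def by blast
qed (use pspan_in[OF assms] in blast)

lemma pspan_mono: "X \<subseteq> Y \<Longrightarrow> pspan X \<subseteq> pspan Y"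
  by (auto simp: point_span_def)

lemma pspan_subspace: "point_subspace P L T \<Longrightarrow> pspan T = T"
  using pspan_least[of T T] pspan_superset[of T] by blast

lemma line_in_pspan:
  assumes "X \<subseteq> P" "a \<in> pspan X" "b \<in> pspan X" "a \<noteq> b" "l \<in> L" "a \<in> l" "b \<in> l"
  shows "l \<subseteq> pspan X"
  using point_subspace_pspan[OF assms(1)] assms unfolding point_subspace_def by blast

text \<open>The points collinear with all of \<open>Y\<close> form a subspace, which contains the
  span of \<open>X\<close> as soon as it contains \<open>X\<close>.\<close>

lemma pspan_perp:
  assumes "X \<subseteq> P" "Y \<subseteq> P" "\<And>x y. x \<in> X \<Longrightarrow> y \<in> Y \<Longrightarrow> perp L x y"
    and "x \<in> pspan X" "y \<in> Y"
  shows "perp L x y"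
proof -
  have "X \<subseteq> {z \<in> P. \<forall>y\<in>Y. perp L y z}" using assms perp_sym by fast
  then have "pspan X \<subseteq> {z \<in> P. \<forall>y\<in>Y. perp L y z}"
    using pspan_least point_subspace_perp[OF assms(2)] by blast
  then show ?thesis using assms perp_sym by fast
qed

lemma singular_pspan:
  assumes X: "X \<subseteq> P" and perp: "\<And>x y. x \<in> X \<Longrightarrow> y \<in> X \<Longrightarrow> perp L x y"
  shows "singular (pspan X)"
  unfolding singular_iff
proof (intro conjI ballI)
  show "point_subspace P L (pspan X)" by (rule point_subspace_pspan[OF X])
  fix p q assume pq: "p \<in> pspan X" "q \<in> pspan X"
  have "perp L x y" if "x \<in> X" "y \<in> pspan X" for x y
    using pspan_perp[OF X X perp that(2,1)] perp_sym by metis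
  then show "perp L p q" by (rule pspan_perp[OF X pspan_in[OF X] _ pq])
qed

lemma singular_line:
  assumes "singular S" "p \<in> S" "q \<in> S" "p \<noteq> q" "l \<in> L" "p \<in> l" "q \<in> l"
  shows "l \<subseteq> S"
  using assms unfolding singular_subspace_def point_subspace_def by simp

lemma singular_Int:
  assumes "singular S" "singular T" shows "singular (S \<inter> T)"
  unfolding singular_iff point_subspace_def
proof (intro conjI ballI impI)
  show "S \<inter> T \<subseteq> P" using singular_sub[OF assms(1)] by blast
  show "l \<subseteq> S \<inter> T"
    if "p \<in> S \<inter> T" "q \<in> S \<inter> T" "p \<noteq> q" "l \<in> L" "p \<in> l \<and> q \<in> l" for p q l
    using singular_line[OF assms(1), of p q l] singular_line[OF assms(2), of p q l] that by simp
  show "perp L p q" if "p \<in> S \<inter> T" "q \<in> S \<inter> T" for p q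
    using assms(1) that by (simp add: singular_iff)
qed

text \<open>The set \<open>J\<close> formed by \<open>p\<close> and the lines through
  \<open>p\<close> that meet \<open>A\<close> is already a subspace. The case in question is a line
  \<open>d\<close> off \<open>p\<close> that joins points of two lines \<open>pa\<close> and
  \<open>pb\<close>: by \<open>triangle_projection\<close>, the line from \<open>p\<close> to any
  point of \<open>d\<close> meets the line \<open>ab\<close>, which lies in
  \<open>A\<close>.\<close>

lemma pspan_insert:
  assumes M: "singular M" and A: "point_subspace P L A" "A \<subseteq> M" and p: "p \<in> M"
    and x: "x \<in> pspan (insert p A)"
  shows "x = p \<or> x \<in> A \<or> (\<exists>a\<in>A. a \<noteq> p \<and> (\<exists>l\<in>L. p \<in> l \<and> a \<in> l \<and> x \<in> l))"
proof (cases "p \<in> A")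
  case True
  then show ?thesis using x pspan_subspace[OF A(1)] by (simp add: insert_absorb)
next
  case False
  define J where "J = {p} \<union> {x. \<exists>a\<in>A. \<exists>l\<in>L. p \<in> l \<and> a \<in> l \<and> x \<in> l}"
  have MP: "M \<subseteq> P" by (rule singular_sub[OF M])
  have perpM: "perp L a b" if "a \<in> M" "b \<in> M" for a b using M that by (simp add: singular_iff)
  have AJ: "insert p A \<subseteq> J"
  proof
    fix a assume "a \<in> insert p A"
    moreover have "a \<in> J" if "a \<in> A"
    proof -
      have "a \<noteq> p" "perp L p a" using that False perpM p A by auto
      then obtain l where "l \<in> L" "p \<in> l" "a \<in> l" using perp_lineE by metis
      then show ?thesis using that by (auto simp: J_def)
    qed
    ultimately show "a \<in> J" by (auto simp: J_def)
  qed
  have "point_subspace P L J"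
    unfolding point_subspace_def
  proof (intro conjI ballI impI subsetI)
    show "y \<in> P" if "y \<in> J" for y using that line_sub p MP by (auto simp: J_def)
  next
    fix u v d w assume u: "u \<in> J" and v: "v \<in> J" and uv: "u \<noteq> v"
      and d: "d \<in> L" "u \<in> d \<and> v \<in> d" and w: "w \<in> d"
    have single: "w \<in> J" if y: "p \<in> d" "y \<in> J" "y \<noteq> p" "y \<in> d" for y
    proof -
      obtain b g where "b \<in> A" "g \<in> L" "p \<in> g" "b \<in> g" "y \<in> g" using y by (auto simp: J_def)
      moreover have "g = d" using line_unique[of g d p y] calculation y d by metis
      ultimately show ?thesis using w by (auto simp: J_def)
    qed
    show "w \<in> J"
    proof (cases "p \<in> d")
      case True
      then show ?thesis using single u v uv d by metis
    next
      case pd: False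
      then have up: "u \<noteq> p" "v \<noteq> p" using d by auto
      obtain a h where a: "a \<in> A" "h \<in> L" "p \<in> h" "a \<in> h" "u \<in> h" using u up by (auto simp: J_def)
      obtain b g where b: "b \<in> A" "g \<in> L" "p \<in> g" "b \<in> g" "v \<in> g" using v up by (auto simp: J_def)
      have "h \<noteq> g" using line_unique[of h d u v] a b d uv pd by metis
      then have ab: "a \<noteq> b" using line_unique[of h g p a] a b False by metis
      obtain c where c: "c \<in> L" "a \<in> c" "b \<in> c" using perpM ab a b A perp_lineE by (metis subsetD)
      have cA: "c \<subseteq> A" using A(1) c ab a b unfolding point_subspace_def by blast
      then have "p \<notin> c" using False by blast
      then have "\<exists>t\<in>c. \<exists>l\<in>L. p \<in> l \<and> t \<in> l \<and> w \<in> l"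
        using triangle_projection[of p c a b h u g v d w] p MP c ab a b up d uv w by blast
      then show ?thesis using cA by (auto simp: J_def)
    qed
  qed
  then have "x \<in> J" using pspan_least AJ x by blast
  then show ?thesis using False by (auto simp: J_def)
qed

text \<open>The carrier is a maximal singular subspace, for which the rank hypothesis supplies a
  finite generating set. Exchange and \<open>cl_insert\<close> both follow from the description of
  spans by lines in \<open>pspan_insert\<close>.\<close>

lemma exchange_closure_maximal:
  assumes "maximal_singular P L M" shows "exchange_closure M pspan"
proof
  have M: "singular M" using assms by (simp add: maximal_singular_def)
  have MP: "M \<subseteq> P" by (rule singular_sub[OF M])
  have Msub: "point_subspace P L M" using M by (simp add: singular_subspace_def)
  show "A \<subseteq> pspan A" for A by (rule pspan_superset)
  show AM: "pspan A \<subseteq> M" if "A \<subseteq> M" for A using pspan_least[OF Msub that] .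
  show "pspan A \<subseteq> pspan B" if "A \<subseteq> B" for A B by (rule pspan_mono[OF that])
  show "pspan (pspan A) = pspan A" if "A \<subseteq> M" for A
    using pspan_subspace point_subspace_pspan that MP by blast
  show "x \<in> pspan (insert y A)"
    if A: "A \<subseteq> M" and x: "x \<in> M" and y: "y \<in> pspan (insert x A)" "y \<notin> pspan A" for A x y
  proof -
    have AP: "insert x A \<subseteq> P" "A \<subseteq> P" using A x MP by auto
    have yP: "insert y A \<subseteq> P" using y AP pspan_in by blast
    have "insert x A \<subseteq> insert x (pspan A)" using pspan_superset by blast
    then have "y \<in> pspan (insert x (pspan A))" using y pspan_mono by blast
    then consider "y = x" | a l where "a \<in> pspan A" "l \<in> L" "x \<in> l" "a \<in> l" "y \<in> l"
      using pspan_insert[OF M point_subspace_pspan[OF AP(2)] AM[OF A] x] y by blast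
    then show ?thesis
    proof cases
      case 1
      then show ?thesis using pspan_superset by blast
    next
      case 2
      have "a \<in> pspan (insert y A)" using 2 pspan_mono[of A "insert y A"] by blast
      moreover have "y \<in> pspan (insert y A)" using pspan_superset by blast
      moreover have "a \<noteq> y" using 2 y by blast
      ultimately show ?thesis using line_in_pspan[OF yP, of a y l] 2 by blast
    qed
  qed
  show "x \<in> pspan {p} \<or> (\<exists>a\<in>A. x \<in> pspan {a, p})"
    if A: "A \<subseteq> M" "pspan A = A" and p: "p \<in> M" and x: "x \<in> pspan (insert p A)" for A p x
  proof -
    have "point_subspace P L A" using point_subspace_pspan[of A] A MP by simp
    from pspan_insert[OF M this A(1) p x]
    consider "x = p" | "x \<in> A" | a l where "a \<in> A" "a \<noteq> p" "l \<in> L" "p \<in> l" "a \<in> l" "x \<in> l" by blast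
    then show ?thesis
    proof cases
      case 1
      then show ?thesis using pspan_superset[of "{p}"] by blast
    next
      case 2
      then show ?thesis using pspan_superset[of "{x, p}"] by blast
    next
      case 3
      have "{a, p} \<subseteq> P" using 3 A p MP by blast
      then have "x \<in> pspan {a, p}"
        using line_in_pspan[of "{a, p}" a p l] pspan_superset[of "{a, p}"] 3 by blast
      then show ?thesis using 3 by blast
    qed
  qed
  show "\<exists>B. finite B \<and> B \<subseteq> M \<and> pspan B = M"
    using rank assms unfolding has_rank_def has_proj_dim_def by blast
qed

text \<open>Projective dimension plus one, so that the empty subspace has rank \<open>0\<close>. The
  definition refers to no maximal singular subspace, so ranks computed inside different ones
  agree.\<close>

definition prk :: "'a set \<Rightarrow> nat" where
  "prk S = (THE d. has_proj_dim P L S (int d - 1))"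

context
  fixes M assumes M: "maximal_singular P L M"
begin

interpretation E: exchange_closure M pspan
  by (rule exchange_closure_maximal[OF M])

text \<open>A proper subset of \<open>B\<close> lies in some \<open>B - {x}\<close>, so testing the
  removal of single points is enough.\<close>

lemma independent_points_iff: "B \<subseteq> M \<Longrightarrow> independent_points P L B \<longleftrightarrow> E.indep B"
proof
  assume B: "B \<subseteq> M" and ind: "independent_points P L B"
  show "E.indep B"
    unfolding E.indep_def
  proof (intro ballI notI)
    fix x assume x: "x \<in> B" "x \<in> pspan (B - {x})"
    then have "B \<subseteq> pspan (B - {x})" using pspan_superset[of "B - {x}"] by blast
    then have "pspan B \<subseteq> pspan (B - {x})" using E.cl_least B by (metis Diff_subset subset_trans)
    moreover have "pspan (B - {x}) \<subseteq> pspan B" using pspan_mono by (metis Diff_subset)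
    ultimately show False using ind x(1) unfolding independent_points_def by blast
  qed
next
  assume B: "B \<subseteq> M" and ind: "E.indep B"
  show "independent_points P L B"
    unfolding independent_points_def
  proof (intro allI impI notI)
    fix Y assume Y: "Y \<subset> B" "pspan Y = pspan B"
    then obtain x where x: "x \<in> B" "x \<notin> Y" by blast
    have "Y \<subseteq> B - {x}" using x Y by blast
    then have "x \<in> pspan (B - {x})" using pspan_mono Y pspan_superset x by blast
    then show False using ind x(1) unfolding E.indep_def by blast
  qed
qed

lemma flat_iff: "S \<subseteq> M \<Longrightarrow> E.flat S \<longleftrightarrow> singular S"
proof
  assume S: "S \<subseteq> M" and "E.flat S"
  have MS: "singular M" using M by (simp add: maximal_singular_def)
  have "point_subspace P L S"
    using point_subspace_pspan[of S] \<open>E.flat S\<close> S singular_sub[OF MS] by (simp add: E.flat_def)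
  then show "singular S" using MS S unfolding singular_iff by blast
next
  assume S: "S \<subseteq> M" "singular S"
  then show "E.flat S" using pspan_subspace by (auto simp: E.flat_def singular_subspace_def)
qed

lemma has_proj_dim_iff_rk:
  assumes S: "S \<subseteq> M" "singular S"
  shows "has_proj_dim P L S e \<longleftrightarrow> e = int (E.rk S) - 1"
proof -
  have "B \<subseteq> S \<and> independent_points P L B \<longleftrightarrow> B \<subseteq> M \<and> E.indep B" if "pspan B = S" for B
    using pspan_superset[of B] that independent_points_iff[of B] S by auto
  then have "has_proj_dim P L S e \<longleftrightarrow> (\<exists>B. E.basis S B \<and> int (card B) - 1 = e)"
    unfolding has_proj_dim_def E.basis_def by (metis (no_types, lifting))
  moreover have "(\<exists>B. E.basis S B \<and> int (card B) - 1 = e) \<longleftrightarrow> int (E.rk S) - 1 = e"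
    using E.basis_exists[of S] E.rk_basis[of S] flat_iff S by metis
  ultimately show ?thesis by auto
qed

lemma prk_eq_rk: "S \<subseteq> M \<Longrightarrow> singular S \<Longrightarrow> prk S = E.rk S"
  unfolding prk_def using has_proj_dim_iff_rk by auto

lemma prk_modular_maximal:
  assumes "S \<subseteq> M" "T \<subseteq> M" "singular S" "singular T"
  shows "prk (S \<inter> T) + prk (pspan (S \<union> T)) = prk S + prk T"
proof -
  have f: "E.flat S" "E.flat T" using flat_iff assms by auto
  have j: "E.flat (pspan (S \<union> T))" using E.flat_join[OF f] by (simp add: E.join_def)
  then have "singular (pspan (S \<union> T))" "pspan (S \<union> T) \<subseteq> M"
    using flat_iff by (auto simp: E.flat_def)
  moreover have "singular (S \<inter> T)" "S \<inter> T \<subseteq> M" using singular_Int assms by auto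
  ultimately show ?thesis using E.rk_modular[OF f] assms by (simp add: prk_eq_rk E.join_def)
qed

lemma prk_mono_maximal:
  assumes "S \<subseteq> T" "T \<subseteq> M" "singular S" "singular T"
  shows "prk S \<le> prk T" "prk S = prk T \<Longrightarrow> S = T"
proof -
  have f: "E.flat S" "E.flat T" using flat_iff assms by auto
  have r: "prk S = E.rk S" "prk T = E.rk T" using prk_eq_rk assms by auto
  show "prk S \<le> prk T" using E.rk_mono[OF f assms(1)] r by simp
  show "prk S = prk T \<Longrightarrow> S = T" using E.rk_eq[OF f assms(1)] r by simp
qed

end

lemma has_proj_dim_iff:
  assumes "singular S" shows "has_proj_dim P L S e \<longleftrightarrow> e = int (prk S) - 1"
proof -
  obtain M where "maximal_singular P L M" "S \<subseteq> M" using maximal_above assms by blast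
  then show ?thesis using has_proj_dim_iff_rk prk_eq_rk assms by simp
qed

lemma prk_mono:
  assumes "S \<subseteq> T" "singular S" "singular T" shows "prk S \<le> prk T"
proof -
  obtain M where "maximal_singular P L M" "T \<subseteq> M" using maximal_above assms by blast
  then show ?thesis using prk_mono_maximal assms by blast
qed

lemma prk_eq:
  assumes "S \<subseteq> T" "singular S" "singular T" "prk S = prk T" shows "S = T"
proof -
  obtain M where "maximal_singular P L M" "T \<subseteq> M" using maximal_above assms by blast
  then show ?thesis using prk_mono_maximal assms by blast
qed

lemma prk_modular:
  assumes "S \<subseteq> U" "T \<subseteq> U" "singular S" "singular T" "singular U"
  shows "prk (S \<inter> T) + prk (pspan (S \<union> T)) = prk S + prk T"
proof -
  obtain M where "maximal_singular P L M" "U \<subseteq> M" using maximal_above assms by blast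
  then show ?thesis using prk_modular_maximal[of M S T] assms by blast
qed

lemma prk_le: assumes "singular S" shows "prk S \<le> n"
proof -
  obtain M where M: "maximal_singular P L M" "S \<subseteq> M" using maximal_above assms by blast
  then have sM: "singular M" by (simp add: maximal_singular_def)
  have "prk M = n" using M rank has_proj_dim_iff[OF sM] by (auto simp: has_rank_def)
  then show ?thesis using prk_mono[OF M(2) assms sM] by simp
qed

lemma polar_grassmannian_iff: "X \<in> polar_grassmannian P L e \<longleftrightarrow> singular X \<and> int (prk X) = e + 1"
  using has_proj_dim_iff unfolding polar_grassmannian_def by auto

end

lemma ranked_polarI:
  assumes polar: "polar_space P L" and rank: "has_rank P L n"
  shows "ranked_polar P L n"
proof -
  note ps = polar[unfolded polar_space_def]
  have pls: "partial_linear_space P L" using ps by (elim conjE)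
  have "\<forall>p\<in>P. \<not> (\<forall>q\<in>P. collinear_points L p q)" using ps by (elim conjE)
  then have nd: "\<exists>q\<in>P. \<not> collinear_points L p q" if "p \<in> P" for p using that by blast
  have "\<forall>p\<in>P. \<forall>l\<in>L. (\<exists>!q. q \<in> l \<and> collinear_points L p q) \<or> (\<forall>q\<in>l. collinear_points L p q)"
    using ps by (elim conjE)
  then have one_all: "(\<exists>!q. q \<in> l \<and> collinear_points L p q) \<or> (\<forall>q\<in>l. collinear_points L p q)"
    if "p \<in> P" "l \<in> L" for p l using that by simp
  have chain: "finite C" if "subset.chain {S. singular_subspace P L S} C" for C
    using ps that by simp
  note pl = pls[unfolded partial_linear_space_def]
  have "\<forall>l\<in>L. l \<subset> P" "\<forall>l\<in>L. \<exists>p\<in>l. \<exists>q\<in>l. p \<noteq> q" using pl by simp_all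
  then have line: "l \<subseteq> P" "\<exists>p. p \<in> l" if "l \<in> L" for l using that by blast+
  have on_line: "\<exists>l\<in>L. p \<in> l" if "p \<in> P" for p using pl that by simp
  have unique: "\<forall>p\<in>P. \<forall>q\<in>P. p \<noteq> q \<longrightarrow>
      (\<forall>l\<in>L. \<forall>l'\<in>L. p \<in> l \<and> q \<in> l \<and> p \<in> l' \<and> q \<in> l' \<longrightarrow> l = l')"
    using pl by (elim conjE)
  have col: "collinear_points L p q \<longleftrightarrow> perp L p q" if "p \<in> P" for p q
    using on_line[OF that] by (auto simp: perp_def collinear_points_def)
  show ?thesis
  proof
    show "l \<subseteq> P" if "l \<in> L" for l using line that by blast
    show "l = l'" if "l \<in> L" "l' \<in> L" "p \<noteq> q" "p \<in> l" "q \<in> l" "p \<in> l'" "q \<in> l'" for l l' p q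
    proof -
      have "p \<in> P" "q \<in> P" using line that by blast+
      then show ?thesis using unique that by simp
    qed
    show "\<exists>q\<in>l. perp L p q" if "p \<in> P" "l \<in> L" for p l
      using one_all[OF that] line(2)[OF that(2)] col[OF that(1)] by metis
    show "perp L p s"
      if "p \<in> P" "l \<in> L" "q \<in> l" "r \<in> l" "q \<noteq> r" "perp L p q" "perp L p r" "s \<in> l" for p l q r s
      using one_all[OF that(1,2)] that col[OF that(1)] by metis
    show "\<exists>q\<in>P. \<not> perp L p q" if "p \<in> P" for p using nd[OF that] col[OF that] by metis
    show "\<exists>l\<in>L. p \<in> l" if "p \<in> P" for p by (rule on_line[OF that])
    show "has_rank P L n" by (rule rank)
    show "\<exists>M. maximal_singular P L M \<and> S \<subseteq> M" if S: "singular_subspace P L S" for S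
    proof -
      let ?F = "{T. singular_subspace P L T \<and> S \<subseteq> T}"
      \<comment> \<open>Zorn's lemma applies because chains are finite: a nonempty finite chain
        contains its union.\<close>
      have "\<exists>M\<in>?F. \<forall>X\<in>?F. M \<subseteq> X \<longrightarrow> X = M"
      proof (rule subset_Zorn_nonempty)
        show "?F \<noteq> {}" using S by blast
        fix C assume C: "C \<noteq> {}" "subset.chain ?F C"
        have "subset.chain {S. singular_subspace P L S} C"
          using C(2) unfolding subset.chain_def by blast
        then have "\<Union> C \<in> C" using chain Union_in_chain C by metis
        then show "\<Union> C \<in> ?F" using C(2) unfolding subset.chain_def by blast
      qed
      then obtain M where M: "singular_subspace P L M" "S \<subseteq> M"
        "\<And>X. singular_subspace P L X \<Longrightarrow> S \<subseteq> X \<Longrightarrow> M \<subseteq> X \<Longrightarrow> X = M" by auto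
      then have "maximal_singular P L M" unfolding maximal_singular_def by (meson subset_trans)
      then show ?thesis using M(2) by blast
    qed
  qed
qed

section \<open>Embeddings of graphs covered by two families of cliques\<close>

context two_clique_graph
begin

text \<open>The pair from \<open>cross\<close> cannot share a clique, so \<open>Z\<close> and
  \<open>W\<close> differ from \<open>X\<close> and \<open>Y\<close> and are common neighbours of
  both. The edge \<open>XY\<close> thus has two nonadjacent common neighbours, which rules out
  \<open>k \<ge> n - 2\<close> later.\<close>

lemma diamond:
  assumes "A \<in> S" "B \<in> T" "X \<in> A \<inter> B" "Y \<in> A \<inter> B" "X \<noteq> Y"
  shows "\<exists>Z\<in>A. \<exists>W\<in>B. Z \<noteq> W \<and> \<not> adj Z W \<and> adj Z X \<and> adj Z Y \<and> adj W X \<and> adj W Y"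
proof -
  obtain Z W where ZW: "Z \<in> A" "W \<in> B" "Z \<noteq> W" "\<not> adj Z W" using cross[OF assms] by blast
  have "Z \<notin> B" using T_adj[OF assms(2) _ ZW(2,3)] ZW(4) by blast
  moreover have "W \<notin> A" using S_adj[OF assms(1) ZW(1) _ ZW(3)] ZW(4) by blast
  ultimately have "Z \<noteq> X" "Z \<noteq> Y" "W \<noteq> X" "W \<noteq> Y" using assms by auto
  then have "adj Z X" "adj Z Y" "adj W X" "adj W Y"
    using S_adj[OF assms(1) ZW(1)] T_adj[OF assms(2) ZW(2)] assms by auto
  then show ?thesis using ZW by blast
qed

text \<open>Connectedness in terms of stars: a property that passes between stars with a common
  vertex holds for all stars once it holds for one. The induction on the distance from
  \<open>X0\<close> shows it for every star through \<open>Y\<close>.\<close>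

lemma S_propagate:
  assumes A0: "A0 \<in> S" "Q A0"
    and step: "\<And>A A' X. \<lbrakk>A \<in> S; A' \<in> S; X \<in> A; X \<in> A'; Q A'\<rbrakk> \<Longrightarrow> Q A"
    and A: "A \<in> S"
  shows "Q A"
proof -
  obtain X0 where X0: "X0 \<in> A0" using S_two A0 by blast
  have X0G: "X0 \<in> G" using X0 S_sub A0 by blast
  have "\<forall>A\<in>S. Y \<in> A \<longrightarrow> Q A" if "Y \<in> G" for Y
    using that
  proof (induction "d X0 Y" arbitrary: Y rule: less_induct)
    case less
    consider "Y = X0" | "adj X0 Y" | "Y \<noteq> X0" "\<not> adj X0 Y" by blast
    then show ?case
    proof cases
      case 1
      then show ?thesis using step A0 X0 by blast
    next
      case 2
      then obtain A1 where A1: "A1 \<in> S" "X0 \<in> A1" "Y \<in> A1" using S_edge X0G less by blast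
      then have "Q A1" using step[OF A1(1) A0(1) A1(2) X0 A0(2)] by blast
      then show ?thesis using step A1 by blast
    next
      case 3
      then obtain A1 Y1 where A1: "A1 \<in> S" "Y \<in> A1" "Y1 \<in> A1" "d X0 Y1 < d X0 Y"
        using S_closer[OF X0G less.prems] by blast
      have "Y1 \<in> G" using A1 S_sub by blast
      then have "Q A1" using less.hyps[OF A1(4)] A1 by blast
      then show ?thesis using step A1 by blast
    qed
  qed
  moreover obtain X where "X \<in> A" using S_two A by blast
  ultimately show ?thesis using A S_sub by blast
qed

end

section \<open>Adjacency and cliques in polar Grassmann graphs\<close>

context ranked_polar
begin

text \<open>Adjacency of \<open>\<Gamma>\<^sub>k(\<Pi>)\<close> for \<open>k \<le> n - 2\<close>,
  with \<open>r = k + 1\<close>; that \<open>X\<close> and \<open>Y\<close> have rank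
  \<open>r\<close> is stated separately by \<open>rank_singular\<close>.\<close>

definition padj :: "nat \<Rightarrow> 'a set \<Rightarrow> 'a set \<Rightarrow> bool" where
  "padj r X Y \<longleftrightarrow> X \<noteq> Y \<and> (\<exists>Z. singular Z \<and> prk Z = Suc r \<and> X \<subseteq> Z \<and> Y \<subseteq> Z)"

definition rank_singular :: "nat \<Rightarrow> 'a set \<Rightarrow> bool" where
  "rank_singular r X \<longleftrightarrow> singular X \<and> prk X = r"

definition sperp :: "'a set \<Rightarrow> 'a set \<Rightarrow> bool" where
  "sperp X Y \<longleftrightarrow> (\<forall>x\<in>X. \<forall>y\<in>Y. perp L x y)"

lemma padj_sym: "padj r X Y \<Longrightarrow> padj r Y X"
  unfolding padj_def by blast

lemma sperp_sym: "sperp X Y \<Longrightarrow> sperp Y X"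
  using perp_sym by (fastforce simp: sperp_def)

lemma sperp_singular: "singular Z \<Longrightarrow> X \<subseteq> Z \<Longrightarrow> Y \<subseteq> Z \<Longrightarrow> sperp X Y"
  by (auto simp: sperp_def singular_iff)

lemma sperp_pspan:
  assumes "X \<subseteq> P" "Y \<subseteq> P" "Z \<subseteq> P" "sperp X Z" "sperp Y Z"
  shows "sperp (pspan (X \<union> Y)) Z"
  unfolding sperp_def
proof (intro ballI)
  fix u z assume uz: "u \<in> pspan (X \<union> Y)" "z \<in> Z"
  show "perp L u z"
    by (rule pspan_perp[OF _ assms(3) _ uz]) (use assms in \<open>auto simp: sperp_def\<close>)
qed

lemma singular_join:
  assumes "singular X" "singular Y" "sperp X Y" shows "singular (pspan (X \<union> Y))"
proof (rule singular_pspan)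
  show "X \<union> Y \<subseteq> P" using assms singular_sub by blast
  show "perp L x y" if "x \<in> X \<union> Y" "y \<in> X \<union> Y" for x y
    using that assms sperp_sym[OF assms(3)] unfolding singular_iff sperp_def by (elim UnE) auto
qed

lemma join_upper: "X \<subseteq> pspan (X \<union> Y)" "Y \<subseteq> pspan (X \<union> Y)"
  using pspan_superset[of "X \<union> Y"] by auto

lemma join_least:
  assumes "singular U" "X \<subseteq> U" "Y \<subseteq> U" shows "pspan (X \<union> Y) \<subseteq> U"
  using pspan_least[of U "X \<union> Y"] assms by (simp add: singular_iff)

lemma singular_join_in:
  assumes "singular X" "singular Y" "singular U" "X \<subseteq> U" "Y \<subseteq> U"
  shows "singular (pspan (X \<union> Y))"
  using singular_join sperp_singular assms by blast

lemma padj_sperp: "padj r X Y \<Longrightarrow> sperp X Y"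
  using sperp_singular unfolding padj_def by blast

text \<open>The span of \<open>X\<close> and \<open>Y\<close> has rank above \<open>r\<close>
  because \<open>X \<noteq> Y\<close>, and at most \<open>r + 1\<close> because it lies in
  \<open>Z\<close>. Modularity then gives the rank of the intersection.\<close>

lemma padj_ranks:
  assumes X: "rank_singular r X" and Y: "rank_singular r Y" and XY: "padj r X Y"
  shows "rank_singular (Suc r) (pspan (X \<union> Y))" "singular (X \<inter> Y)" "Suc (prk (X \<inter> Y)) = r"
proof -
  obtain Z where Z: "singular Z" "prk Z = Suc r" "X \<subseteq> Z" "Y \<subseteq> Z" and ne: "X \<noteq> Y"
    using XY by (auto simp: padj_def)
  let ?U = "pspan (X \<union> Y)"
  have s: "singular X" "singular Y" "prk X = r" "prk Y = r" using X Y by (auto simp: rank_singular_def)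
  have U: "singular ?U" by (rule singular_join_in[OF s(1,2) Z(1,3,4)])
  have "prk ?U \<le> Suc r" using prk_mono[OF join_least[OF Z(1,3,4)] U Z(1)] Z(2) by simp
  moreover have "prk ?U \<noteq> r"
    using prk_eq[OF join_upper(1) s(1) U] prk_eq[OF join_upper(2) s(2) U] s ne by metis
  moreover have "r \<le> prk ?U" using prk_mono[OF join_upper(1) s(1) U] s by simp
  ultimately have rU: "prk ?U = Suc r" by linarith
  then show "rank_singular (Suc r) ?U" using U by (simp add: rank_singular_def)
  show "singular (X \<inter> Y)" using singular_Int s by blast
  show "Suc (prk (X \<inter> Y)) = r" using prk_modular[OF Z(3,4) s(1,2) Z(1)] s rU by simp
qed

lemma padj_below:
  assumes "rank_singular (Suc r) U" "X \<subseteq> U" "Y \<subseteq> U" "X \<noteq> Y" shows "padj r X Y"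
  using assms by (auto simp: padj_def rank_singular_def)

lemma join_hyperplanes:
  assumes Z: "rank_singular r Z" and A: "singular A" "singular B" "A \<subseteq> Z" "B \<subseteq> Z" "A \<noteq> B"
    and rk: "Suc (prk A) = r" "Suc (prk B) = r"
  shows "pspan (A \<union> B) = Z"
proof -
  have Z': "singular Z" "prk Z = r" using Z by (auto simp: rank_singular_def)
  have J: "singular (pspan (A \<union> B))" by (rule singular_join_in[OF A(1,2) Z'(1) A(3,4)])
  have sub: "pspan (A \<union> B) \<subseteq> Z" by (rule join_least[OF Z'(1) A(3,4)])
  have "prk (pspan (A \<union> B)) \<noteq> prk A"
    using prk_eq[OF join_upper(1) A(1) J] prk_eq[OF join_upper(2) A(2) J] rk A(5) by (metis Suc_inject)
  moreover have "prk A \<le> prk (pspan (A \<union> B))" by (rule prk_mono[OF join_upper(1) A(1) J])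
  moreover have "prk (pspan (A \<union> B)) \<le> r" using prk_mono[OF sub J Z'(1)] Z' by simp
  ultimately have "prk (pspan (A \<union> B)) = prk Z" using rk Z' by linarith
  then show ?thesis using prk_eq[OF sub J Z'(1)] by blast
qed

text \<open>\<open>W\<close> meets \<open>X\<close> and \<open>Y\<close> in two different
  hyperplanes of \<open>W\<close>, and these generate \<open>W\<close>.\<close>

lemma padj_triangle_two:
  assumes X: "rank_singular r X" and Y: "rank_singular r Y" and W: "rank_singular r W"
    and XY: "padj r X Y" and WX: "padj r W X" and WY: "padj r W Y"
    and ne: "W \<inter> X \<noteq> W \<inter> Y"
  shows "W \<subseteq> pspan (X \<union> Y)"
proof -
  have "pspan ((W \<inter> X) \<union> (W \<inter> Y)) = W"
    by (rule join_hyperplanes[OF W])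
      (use padj_ranks[OF W X WX] padj_ranks[OF W Y WY] ne in auto)
  moreover have "pspan ((W \<inter> X) \<union> (W \<inter> Y)) \<subseteq> pspan (X \<union> Y)" by (rule pspan_mono) blast
  ultimately show ?thesis by blast
qed

text \<open>If the two hyperplanes of \<open>W\<close> coincide, they lie in
  \<open>X \<inter> Y\<close>, which has the same rank.\<close>

lemma padj_triangle:
  assumes X: "rank_singular r X" and Y: "rank_singular r Y" and W: "rank_singular r W"
    and XY: "padj r X Y" and WX: "padj r W X" and WY: "padj r W Y"
  shows "W \<inter> X = X \<inter> Y \<and> W \<inter> Y = X \<inter> Y \<or> W \<subseteq> pspan (X \<union> Y)"
proof (cases "W \<inter> X = W \<inter> Y")
  case True
  then have "W \<inter> X \<subseteq> X \<inter> Y" by blast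
  then have "W \<inter> X = X \<inter> Y"
    using prk_eq[of "W \<inter> X" "X \<inter> Y"] padj_ranks(2,3)[OF W X WX] padj_ranks(2,3)[OF X Y XY] by simp
  then show ?thesis using True by simp
qed (use padj_triangle_two[OF assms] in simp)

definition in_star :: "nat \<Rightarrow> 'a set set \<Rightarrow> bool" where
  "in_star r F \<longleftrightarrow> (\<exists>A. singular A \<and> Suc (prk A) = r \<and> (\<forall>X\<in>F. A \<subseteq> X))"

definition in_top :: "nat \<Rightarrow> 'a set set \<Rightarrow> bool" where
  "in_top r F \<longleftrightarrow> (\<exists>U. rank_singular (Suc r) U \<and> (\<forall>X\<in>F. X \<subseteq> U))"

text \<open>Suppose some \<open>Z\<close> in the clique does not contain
  \<open>X \<inter> Y\<close>; then \<open>Z\<close> lies in the span of \<open>X\<close> and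
  \<open>Y\<close>. Any other \<open>W\<close> lies there too: if it passes through
  \<open>X \<inter> Y\<close>, it meets \<open>X\<close> and \<open>Z\<close> in different
  hyperplanes and so lies in the span of \<open>X\<close> and \<open>Z\<close>.\<close>

lemma padj_clique:
  assumes F: "\<And>X. X \<in> F \<Longrightarrow> rank_singular r X"
    and adj: "\<And>X Y. X \<in> F \<Longrightarrow> Y \<in> F \<Longrightarrow> X \<noteq> Y \<Longrightarrow> padj r X Y"
    and two: "X \<in> F" "Y \<in> F" "X \<noteq> Y"
  shows "in_star r F \<or> in_top r F"
proof (cases "\<forall>Z\<in>F. X \<inter> Y \<subseteq> Z")
  case True
  have XY: "padj r X Y" using adj two by blast
  have "singular (X \<inter> Y) \<and> Suc (prk (X \<inter> Y)) = r" using padj_ranks(2,3)[OF F F XY] two by blast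
  then show ?thesis using True unfolding in_star_def by blast
next
  case False
  then obtain Z where Z: "Z \<in> F" "\<not> X \<inter> Y \<subseteq> Z" by blast
  let ?U = "pspan (X \<union> Y)"
  have rs: "rank_singular r X" "rank_singular r Y" "rank_singular r Z" using F two Z by auto
  have XY: "padj r X Y" using adj two by blast
  have Zne: "Z \<noteq> X" "Z \<noteq> Y" using Z by auto
  have ZX: "padj r Z X" and ZY: "padj r Z Y" using adj two Z Zne by blast+
  have ZU: "Z \<subseteq> ?U" using padj_triangle[OF rs XY ZX ZY] Z(2) by blast
  have "W \<subseteq> ?U" if W: "W \<in> F" for W
  proof -
    consider "W = X" | "W = Y" | "W = Z" | "W \<noteq> X" "W \<noteq> Y" "W \<noteq> Z" by blast
    then show ?thesis
    proof cases
      case 4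
      have rW: "rank_singular r W" using F W by blast
      have WX: "padj r W X" and WY: "padj r W Y" and WZ: "padj r W Z"
        using adj W two Z 4 by blast+
      from padj_triangle[OF rs(1,2) rW XY WX WY] show ?thesis
      proof (elim disjE conjE)
        assume eq: "W \<inter> X = X \<inter> Y" "W \<inter> Y = X \<inter> Y"
        have "W \<inter> X \<noteq> W \<inter> Z" using eq Z(2) by blast
        then have "W \<subseteq> pspan (X \<union> Z)"
          using padj_triangle_two[OF rs(1,3) rW padj_sym[OF ZX] WX WZ] by blast
        moreover have "singular ?U"
          using padj_ranks(1)[OF rs(1,2) XY] by (simp add: rank_singular_def)
        then have "pspan (X \<union> Z) \<subseteq> ?U" by (rule join_least[OF _ join_upper(1) ZU])
        ultimately show ?thesis by blast
      qed
    qed (use join_upper ZU in auto)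
  qed
  then show ?thesis using padj_ranks(1)[OF rs(1,2) XY] unfolding in_top_def by blast
qed

end

section \<open>Embeddings into polar Grassmann graphs\<close>

locale polar_clique_embedding = ranked_polar P L n + two_clique_graph G adj S T d
  for P :: "'p set" and L :: "'p set set" and n :: nat
    and G :: "'g set" and adj S T d +
  fixes f :: "'g \<Rightarrow> 'p set" and r :: nat
  assumes f_rank: "X \<in> G \<Longrightarrow> rank_singular r (f X)"
    and f_inj: "\<lbrakk>X \<in> G; Y \<in> G; X \<noteq> Y\<rbrakk> \<Longrightarrow> f X \<noteq> f Y"
    and f_adj: "\<lbrakk>X \<in> G; Y \<in> G\<rbrakk> \<Longrightarrow> adj X Y \<longleftrightarrow> padj r (f X) (f Y)"
begin

text \<open>Interpreted below as \<open>D\<close>, this turns each result about stars into one about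
  tops.\<close>

lemma swap: "polar_clique_embedding P L n G adj T S d f r"
proof -
  interpret swap: two_clique_graph G adj T S d by (rule two_clique_graph_swap)
  show ?thesis by unfold_locales (use f_rank f_inj f_adj in blast)+
qed

lemma clique_type: "A \<in> S \<Longrightarrow> in_star r (f ` A) \<or> in_top r (f ` A)"
proof -
  assume A: "A \<in> S"
  have AG: "A \<subseteq> G" by (rule S_sub[OF A])
  obtain X Y where XY: "X \<in> A" "Y \<in> A" "X \<noteq> Y" using S_two[OF A] by blast
  show ?thesis
  proof (rule padj_clique)
    show "rank_singular r Z" if "Z \<in> f ` A" for Z using that f_rank AG by blast
    show "padj r Z W" if "Z \<in> f ` A" "W \<in> f ` A" "Z \<noteq> W" for Z W
      using that f_adj AG S_adj[OF A] by blast
    show "f X \<in> f ` A" "f Y \<in> f ` A" using XY by auto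
    show "f X \<noteq> f Y" using f_inj XY AG by blast
  qed
qed

text \<open>A single edge determines the centre of every star-type clique through it, by equality of
  ranks; \<open>top_join\<close> is the counterpart for top type.\<close>

lemma star_meet:
  assumes XY: "X \<in> G" "Y \<in> G" "X \<noteq> Y" "adj X Y"
    and K: "singular K" "Suc (prk K) = r" "K \<subseteq> f X" "K \<subseteq> f Y"
  shows "f X \<inter> f Y = K"
proof -
  have p: "padj r (f X) (f Y)" using f_adj XY by blast
  note R = padj_ranks(2,3)[OF f_rank[OF XY(1)] f_rank[OF XY(2)] p]
  show ?thesis using prk_eq[of K "f X \<inter> f Y"] R K by simp
qed

lemma top_join:
  assumes XY: "X \<in> G" "Y \<in> G" "X \<noteq> Y" "adj X Y"
    and U: "rank_singular (Suc r) U" "f X \<subseteq> U" "f Y \<subseteq> U"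
  shows "pspan (f X \<union> f Y) = U"
proof -
  have p: "padj r (f X) (f Y)" using f_adj XY by blast
  note R = padj_ranks(1)[OF f_rank[OF XY(1)] f_rank[OF XY(2)] p]
  show ?thesis
    using prk_eq[OF join_least[of U "f X" "f Y"]] R U by (simp add: rank_singular_def)
qed

text \<open>Both images would lie in the span of \<open>f X\<close> and \<open>f Y\<close>, whose
  distinct subspaces of rank \<open>r\<close> are all adjacent, against
  \<open>cross\<close>.\<close>

lemma not_both_top:
  assumes A: "A \<in> S" and B: "B \<in> T" and XY: "X \<in> A \<inter> B" "Y \<in> A \<inter> B" "X \<noteq> Y"
    and tA: "in_top r (f ` A)" and tB: "in_top r (f ` B)"
  shows False
proof -
  have G: "A \<subseteq> G" "B \<subseteq> G" using S_sub T_sub A B by auto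
  have XYG: "X \<in> G" "Y \<in> G" using G XY by auto
  have aXY: "adj X Y" using S_adj[OF A] XY by blast
  obtain U where U: "rank_singular (Suc r) U" "\<And>X. X \<in> A \<Longrightarrow> f X \<subseteq> U"
    using tA by (auto simp: in_top_def)
  obtain V where V: "rank_singular (Suc r) V" "\<And>X. X \<in> B \<Longrightarrow> f X \<subseteq> V"
    using tB by (auto simp: in_top_def)
  have "U = V" using top_join[OF XYG XY(3) aXY U(1)] top_join[OF XYG XY(3) aXY V(1)] U V XY by auto
  obtain Z W where ZW: "Z \<in> A" "W \<in> B" "Z \<noteq> W" "\<not> adj Z W" using cross[OF A B XY] by blast
  have ZWG: "Z \<in> G" "W \<in> G" using ZW G by auto
  have "padj r (f Z) (f W)"
    using padj_below[OF U(1)] U(2)[OF ZW(1)] V(2)[OF ZW(2)] \<open>U = V\<close> f_inj[OF ZWG ZW(3)] by blast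
  then show False using f_adj ZWG ZW by blast
qed

text \<open>A top \<open>B\<close> through \<open>X\<close> and \<open>Z\<close> meets
  \<open>A'\<close> in an edge \<open>XY\<close>. The centre of the image of \<open>B\<close> is
  \<open>f X \<inter> f Y\<close>, which is also \<open>K\<close>, and it is contained in
  \<open>f Z\<close>.\<close>

lemma star_center_transfer:
  assumes A: "A \<in> S" "A' \<in> S" "X \<in> A" "X \<in> A'" and Z: "Z \<in> A"
    and K: "singular K" "Suc (prk K) = r" "\<And>Y. Y \<in> A' \<Longrightarrow> K \<subseteq> f Y"
    and B: "\<And>B. \<lbrakk>B \<in> T; X \<in> B; Z \<in> B; Z \<noteq> X\<rbrakk> \<Longrightarrow> in_star r (f ` B)"
  shows "K \<subseteq> f Z"
proof (cases "Z = X")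
  case True
  then show ?thesis using K A by blast
next
  case ne: False
  obtain B Y where BY: "B \<in> T" "Z \<in> B" "X \<in> B" "Y \<in> A'" "Y \<in> B" "Y \<noteq> X"
    using S_transfer[OF A(1,2) _ Z ne] A by blast
  have G: "X \<in> G" "Y \<in> G" "Z \<in> G" using T_sub[OF BY(1)] BY by auto
  obtain K' where K': "singular K'" "Suc (prk K') = r" "\<And>Y. Y \<in> B \<Longrightarrow> K' \<subseteq> f Y"
    using B[OF BY(1,3,2) ne] by (auto simp: in_star_def)
  have aXY: "adj X Y" using T_adj[OF BY(1,3,5)] BY(6) by blast
  have "f X \<inter> f Y = K"
    using star_meet[OF G(1,2) _ aXY K(1,2)] K(3) BY A by blast
  moreover have "f X \<inter> f Y = K'"
    using star_meet[OF G(1,2) _ aXY K'(1,2)] K'(3) BY by blast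
  ultimately show ?thesis using K'(3)[OF BY(2)] by blast
qed

text \<open>If the neighbouring star \<open>A\<close> had no star type, it would have top type, and
  by \<open>not_both_top\<close> every top that shares an edge with it would have star type. Then
  \<open>star_center_transfer\<close> carries the centre \<open>K\<close> to all of
  \<open>A\<close>, a contradiction.\<close>

lemma star_type_propagates:
  assumes A0: "A0 \<in> S" "in_star r (f ` A0)" and A: "A \<in> S" shows "in_star r (f ` A)"
proof (rule S_propagate[of A0 "\<lambda>A. in_star r (f ` A)", OF A0 _ A])
  fix A A' X
  assume AA: "A \<in> S" "A' \<in> S" "X \<in> A" "X \<in> A'" and st: "in_star r (f ` A')"
  interpret D: polar_clique_embedding P L n G adj T S d f r by (rule swap)
  obtain K where K: "singular K" "Suc (prk K) = r" "\<And>Y. Y \<in> A' \<Longrightarrow> K \<subseteq> f Y"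
    using st by (auto simp: in_star_def)
  show "in_star r (f ` A)"
  proof (rule ccontr)
    assume n: "\<not> in_star r (f ` A)"
    then have tA: "in_top r (f ` A)" using clique_type AA by blast
    have "K \<subseteq> f Z" if Z: "Z \<in> A" for Z
    proof (rule star_center_transfer[OF AA Z K])
      fix B assume B: "B \<in> T" "X \<in> B" "Z \<in> B" "Z \<noteq> X"
      show "in_star r (f ` B)"
        using D.clique_type[OF B(1)] not_both_top[OF AA(1) B(1) _ _ B(4) tA] B Z AA by blast
    qed
    then have "in_star r (f ` A)" using K by (auto simp: in_star_def)
    then show False using n by blast
  qed
qed

lemma common_center:
  assumes A0: "A0 \<in> S" "in_star r (f ` A0)" and T: "\<And>B. B \<in> T \<Longrightarrow> in_star r (f ` B)"
  shows "\<exists>K. singular K \<and> Suc (prk K) = r \<and> (\<forall>X\<in>G. K \<subseteq> f X)"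
proof -
  obtain K where K: "singular K" "Suc (prk K) = r" "\<And>Y. Y \<in> A0 \<Longrightarrow> K \<subseteq> f Y"
    using A0 by (auto simp: in_star_def)
  have "\<forall>X\<in>A. K \<subseteq> f X" if "A \<in> S" for A
  proof (rule S_propagate[of A0 "\<lambda>A. \<forall>X\<in>A. K \<subseteq> f X", OF A0(1) _ _ that])
    show "\<forall>X\<in>A0. K \<subseteq> f X" using K by blast
    fix A A' X
    assume AA: "A \<in> S" "A' \<in> S" "X \<in> A" "X \<in> A'" and st: "\<forall>X\<in>A'. K \<subseteq> f X"
    show "\<forall>Z\<in>A. K \<subseteq> f Z"
      using star_center_transfer[OF AA _ K(1,2)] st T by blast
  qed
  then have "\<forall>X\<in>G. K \<subseteq> f X" using S_vertex by blast
  then show ?thesis using K by blast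
qed

text \<open>Induction on the distance. \<open>Y\<close> lies in a star with two closer vertices
  \<open>Y1\<close> and \<open>Y2\<close>; as the image of the star has top type, \<open>f Y\<close>
  is contained in the span of \<open>f Y1\<close> and \<open>f Y2\<close>, which is collinear with
  \<open>f X\<close>.\<close>

lemma all_perp:
  assumes top: "\<And>A. A \<in> S \<Longrightarrow> in_top r (f ` A)" and XG: "X \<in> G" and YG: "Y \<in> G"
  shows "sperp (f X) (f Y)"
  using YG
proof (induction "d X Y" arbitrary: Y rule: less_induct)
  case less
  have sX: "singular (f X)" using f_rank[OF XG] by (simp add: rank_singular_def)
  consider "Y = X" | "adj X Y" | "X \<noteq> Y" "\<not> adj X Y" by blast
  then show ?case
  proof cases
    case 1
    then show ?thesis using sperp_singular sX by blast
  next
    case 2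
    then show ?thesis using f_adj XG less padj_sperp by blast
  next
    case 3
    obtain A Y1 Y2 where A: "A \<in> S" "Y \<in> A" "Y1 \<in> A" "Y2 \<in> A" "Y1 \<noteq> Y2"
      "d X Y1 < d X Y" "d X Y2 < d X Y" using S_closer[OF XG less.prems 3] by blast
    have G: "Y1 \<in> G" "Y2 \<in> G" using S_sub[OF A(1)] A by auto
    have aY: "adj Y1 Y2" using S_adj A by blast
    obtain U where U: "rank_singular (Suc r) U" "\<And>X. X \<in> A \<Longrightarrow> f X \<subseteq> U"
      using top[OF A(1)] by (auto simp: in_top_def)
    have "f Y \<subseteq> pspan (f Y1 \<union> f Y2)" using top_join[OF G A(5) aY U(1)] U(2) A by blast
    moreover have sub: "f X \<subseteq> P" "f Y1 \<subseteq> P" "f Y2 \<subseteq> P"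
      using f_rank XG G singular_sub unfolding rank_singular_def by blast+
    moreover have "sperp (pspan (f Y1 \<union> f Y2)) (f X)"
      by (rule sperp_pspan[OF sub(2,3,1) sperp_sym[OF less.hyps[OF A(6) G(1)]]
            sperp_sym[OF less.hyps[OF A(7) G(2)]]])
    ultimately have "sperp (f Y) (f X)" unfolding sperp_def by blast
    then show ?thesis by (rule sperp_sym)
  qed
qed

lemma common_singular:
  assumes top: "\<And>A. A \<in> S \<Longrightarrow> in_top r (f ` A)"
  shows "\<exists>U. singular U \<and> (\<forall>X\<in>G. f X \<subseteq> U)"
proof (intro exI conjI ballI)
  show "singular (pspan (\<Union>X\<in>G. f X))"
  proof (rule singular_pspan)
    show "(\<Union>X\<in>G. f X) \<subseteq> P" using f_rank singular_sub unfolding rank_singular_def by blast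
    show "perp L x y" if "x \<in> (\<Union>X\<in>G. f X)" "y \<in> (\<Union>X\<in>G. f X)" for x y
      using all_perp[OF top] that unfolding sperp_def by blast
  qed
  show "f X \<subseteq> pspan (\<Union>X\<in>G. f X)" if "X \<in> G" for X
    using that pspan_superset[of "\<Union>X\<in>G. f X"] by blast
qed

text \<open>If neither family consists of top-type images only, some star and some top have star
  type. Star type then spreads to all tops, and \<open>common_center\<close> yields the common
  subspace \<open>K\<close>.\<close>

theorem embedding_dichotomy:
  "(\<exists>U. singular U \<and> (\<forall>X\<in>G. f X \<subseteq> U)) \<or>
   (\<exists>K. singular K \<and> Suc (prk K) = r \<and> (\<forall>X\<in>G. K \<subseteq> f X))"
proof -
  interpret D: polar_clique_embedding P L n G adj T S d f r by (rule swap)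
  show ?thesis
  proof (cases "(\<forall>A\<in>S. in_top r (f ` A)) \<or> (\<forall>B\<in>T. in_top r (f ` B))")
    case True
    then show ?thesis using common_singular D.common_singular by blast
  next
    case False
    then obtain A B where AB: "A \<in> S" "\<not> in_top r (f ` A)" "B \<in> T" "\<not> in_top r (f ` B)" by blast
    then have "in_star r (f ` A)" "in_star r (f ` B)" using clique_type D.clique_type by blast+
    then show ?thesis using common_center[OF AB(1)] D.star_type_propagates[OF AB(3)] by blast
  qed
qed

text \<open>If \<open>r + 1 = n\<close>, the span \<open>?U\<close> of \<open>f X\<close> and
  \<open>f Y\<close> already has the greatest possible rank. The image of a common neighbour of
  \<open>X\<close> and \<open>Y\<close> is collinear with \<open>?U\<close>, hence contained in it.
  So any two distinct common neighbours are adjacent, against \<open>diamond\<close>.\<close>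

lemma rank_bound: assumes "r < n" shows "Suc r < n"
proof (rule ccontr)
  assume "\<not> Suc r < n"
  then have n: "n = Suc r" using assms by simp
  obtain X where "X \<in> G" using nonempty by blast
  then obtain A where A: "A \<in> S" using S_vertex by blast
  obtain X Y where XY: "X \<in> A" "Y \<in> A" "X \<noteq> Y" using S_two[OF A] by blast
  have XYG: "X \<in> G" "Y \<in> G" using XY S_sub A by auto
  have aXY: "adj X Y" using S_adj A XY by blast
  obtain B where B: "B \<in> T" "X \<in> B" "Y \<in> B" using T_edge[OF XYG aXY] by blast
  obtain Z W where ZW: "Z \<in> A" "W \<in> B" "Z \<noteq> W" "\<not> adj Z W" "adj Z X" "adj Z Y" "adj W X" "adj W Y"
    using diamond[OF A B(1), of X Y] XY B by blast
  have ZWG: "Z \<in> G" "W \<in> G" using ZW S_sub[OF A] T_sub[OF B(1)] by auto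
  have pXY: "padj r (f X) (f Y)" using f_adj XYG aXY by blast
  let ?U = "pspan (f X \<union> f Y)"
  have U: "rank_singular (Suc r) ?U" by (rule padj_ranks(1)[OF f_rank[OF XYG(1)] f_rank[OF XYG(2)] pXY])
  then have sU: "singular ?U" "prk ?U = n" using n by (auto simp: rank_singular_def)
  have "f V \<subseteq> ?U" if V: "V \<in> G" "adj V X" "adj V Y" for V
  proof -
    have sub: "f X \<subseteq> P" "f Y \<subseteq> P" "f V \<subseteq> P" and sV: "singular (f V)"
      using f_rank XYG V singular_sub unfolding rank_singular_def by blast+
    have "padj r (f V) (f X)" "padj r (f V) (f Y)" using f_adj V XYG by blast+
    then have "sperp ?U (f V)" using sperp_pspan[OF sub] padj_sperp padj_sym by blast
    then have J: "singular (pspan (?U \<union> f V))" using singular_join[OF sU(1) sV] by blast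
    have "prk (pspan (?U \<union> f V)) = prk ?U"
      using prk_le[OF J] prk_mono[OF join_upper(1) sU(1) J] sU by simp
    then have "?U = pspan (?U \<union> f V)" using prk_eq[OF join_upper(1) sU(1) J] by simp
    then show ?thesis using join_upper(2)[of "f V" ?U] by simp
  qed
  then have "f Z \<subseteq> ?U" "f W \<subseteq> ?U" using ZWG ZW by auto
  then have "padj r (f Z) (f W)" using padj_below[OF U] f_inj[OF ZWG ZW(3)] by simp
  then show False using f_adj ZWG ZW by blast
qed

end

text \<open>The case \<open>k = n - 1\<close>. If \<open>X \<inter> Y\<close> is not in
  \<open>Z\<close>, then \<open>X\<close> and \<open>Y\<close> are generated by their intersections
  with each other and with \<open>Z\<close>. These three intersections are mutually collinear, so
  \<open>X\<close> and \<open>Y\<close> are collinear and lie in one singular subspace of rank at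
  most \<open>n\<close>; hence \<open>X = Y\<close>.\<close>

lemma (in ranked_polar) dual_polar_triangle:
  assumes s: "singular X" "singular Y" "singular Z" and n: "prk X = n" "prk Y = n" "prk Z = n"
    and r: "Suc (prk (X \<inter> Y)) = n" "Suc (prk (X \<inter> Z)) = n" "Suc (prk (Y \<inter> Z)) = n"
  shows "X \<inter> Y \<subseteq> Z"
proof (rule ccontr)
  assume nsub: "\<not> X \<inter> Y \<subseteq> Z"
  have rs: "rank_singular n X" "rank_singular n Y" using s n by (auto simp: rank_singular_def)
  have I: "singular (X \<inter> Y)" "singular (X \<inter> Z)" "singular (Y \<inter> Z)" using singular_Int s by auto
  have X: "pspan ((X \<inter> Y) \<union> (X \<inter> Z)) = X"
    by (rule join_hyperplanes[OF rs(1) I(1,2)]) (use nsub r in auto)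
  have Y: "pspan ((X \<inter> Y) \<union> (Y \<inter> Z)) = Y"
    by (rule join_hyperplanes[OF rs(2) I(1,3)]) (use nsub r in auto)
  have P: "X \<subseteq> P" "Y \<subseteq> P" "Z \<subseteq> P"
    by (simp_all add: s singular_sub)
  have "sperp (X \<inter> Z) Y"
  proof -
    have "sperp (X \<inter> Y) (X \<inter> Z)" by (rule sperp_singular[OF s(1)]) auto
    moreover have "sperp (Y \<inter> Z) (X \<inter> Z)" by (rule sperp_singular[OF s(3)]) auto
    ultimately have "sperp (pspan ((X \<inter> Y) \<union> (Y \<inter> Z))) (X \<inter> Z)"
      by (intro sperp_pspan) (use P in auto)
    then have "sperp Y (X \<inter> Z)" using Y by simp
    then show ?thesis by (rule sperp_sym)
  qed
  moreover have "sperp (X \<inter> Y) Y" by (rule sperp_singular[OF s(2)]) auto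
  ultimately have "sperp (pspan ((X \<inter> Y) \<union> (X \<inter> Z))) Y"
    by (intro sperp_pspan) (use P in auto)
  then have "sperp X Y" using X by simp
  then have J: "singular (pspan (X \<union> Y))" using singular_join s by blast
  have "prk (pspan (X \<union> Y)) = n"
    using prk_le[OF J] prk_mono[OF join_upper(1) s(1) J] n by simp
  then have "X = pspan (X \<union> Y)" "Y = pspan (X \<union> Y)"
    using prk_eq[OF join_upper(1) s(1) J] prk_eq[OF join_upper(2) s(2) J] n by auto
  then have "X = Y" by simp
  then show False using r n by simp
qed

text \<open>Both \<open>Z\<close> and \<open>W\<close> contain \<open>X \<inter> Y\<close> by
  \<open>dual_polar_triangle\<close>, so their intersection has rank at least
  \<open>n - 1\<close>.\<close>

lemma (in ranked_polar) dual_polar_no_diamond: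
  assumes "singular X" "singular Y" "singular Z" "singular W"
    and "prk X = n" "prk Y = n" "prk Z = n" "prk W = n"
    and "Suc (prk (X \<inter> Y)) = n" "Suc (prk (X \<inter> Z)) = n" "Suc (prk (Y \<inter> Z)) = n"
    and "Suc (prk (X \<inter> W)) = n" "Suc (prk (Y \<inter> W)) = n" and "Z \<noteq> W"
  shows "Suc (prk (Z \<inter> W)) = n"
proof -
  have I: "singular (X \<inter> Y)" "singular (Z \<inter> W)" using singular_Int assms by auto
  have "X \<inter> Y \<subseteq> Z \<inter> W" using dual_polar_triangle assms by blast
  then have "prk (X \<inter> Y) \<le> prk (Z \<inter> W)" using prk_mono I by blast
  moreover have "prk (Z \<inter> W) \<le> n" using prk_le I by blast
  moreover have "prk (Z \<inter> W) \<noteq> n"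
  proof
    assume "prk (Z \<inter> W) = n"
    then have "Z \<inter> W = Z" "Z \<inter> W = W"
      using prk_eq[OF _ I(2) assms(3)] prk_eq[OF _ I(2) assms(4)] assms by auto
    then show False using assms by blast
  qed
  ultimately show ?thesis using assms by linarith
qed

theorem theorem1:
  fixes scale :: "'d::division_ring \<Rightarrow> 'v::ab_group_add \<Rightarrow> 'v"
    and P :: "'p set" and L :: "'p set set"
    and m i n k :: nat
    and f :: "'v set \<Rightarrow> 'p set"
  assumes "left_vector_space scale"
    and "has_lin_dim scale UNIV m"
    and "1 < i" and "i < m - 1"
    and "polar_space P L"
    and "has_rank P L n"
    and "k < n"
    and "graph_embedding (grassmannian scale i) (grassmann_adj scale i)
           (polar_grassmannian P L (int k)) (polar_grassmann_adj P L n (int k)) f"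
  shows "int k \<le> int n - 3 \<and>
    ((k \<ge> 1 \<and> (\<exists>U. singular_subspace P L U \<and>
         f ` grassmannian scale i \<subseteq> elements_below P L (int k) U)) \<or>
     (\<exists>S \<in> polar_grassmannian P L (int k - 1).
         f ` grassmannian scale i \<subseteq> elements_above P L (int k) S))"
proof -
  let ?G = "grassmannian scale i" and ?adj = "grassmann_adj scale i"
  interpret ranked_polar P L n by (rule ranked_polarI[OF assms(5,6)])
  obtain S T d where graph: "two_clique_graph ?G ?adj S T d"
    using left_vector_space.two_clique_graph_grassmannian[OF assms(1-4)] by blast
  interpret two_clique_graph ?G ?adj S T d by (rule graph)
  have fin: "f X \<in> polar_grassmannian P L (int k)" if "X \<in> ?G" for X
    using assms(8) that unfolding graph_embedding_def by blast
  have frank: "rank_singular (Suc k) (f X)" if "X \<in> ?G" for X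
    using fin[OF that] unfolding polar_grassmannian_iff rank_singular_def by simp
  then have fs: "singular (f X)" "prk (f X) = Suc k" if "X \<in> ?G" for X
    using that by (auto simp: rank_singular_def)
  have finj: "f X \<noteq> f Y" if "X \<in> ?G" "Y \<in> ?G" "X \<noteq> Y" for X Y
    using assms(8) that unfolding graph_embedding_def inj_on_def by blast
  have fadj: "?adj X Y \<longleftrightarrow> polar_grassmann_adj P L n (int k) (f X) (f Y)"
    if "X \<in> ?G" "Y \<in> ?G" for X Y
    using assms(8) that unfolding graph_embedding_def by blast
  \<comment> \<open>For \<open>k = n - 1\<close> adjacency is defined by intersections. There
    \<open>dual_polar_no_diamond\<close> excludes the two nonadjacent common neighbours that
    \<open>diamond\<close> provides.\<close>
  have kn: "Suc k < n"
  proof (rule ccontr)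
    assume "\<not> Suc k < n"
    then have k: "n = Suc k" using assms(7) by simp
    have adj_iff: "?adj X Y \<longleftrightarrow> Suc (prk (f X \<inter> f Y)) = n" if XY: "X \<in> ?G" "Y \<in> ?G" "X \<noteq> Y" for X Y
    proof -
      have "singular (f X \<inter> f Y)" using singular_Int fs XY by blast
      then show ?thesis
        unfolding fadj[OF XY(1,2)] polar_grassmann_adj_def
        using fin XY finj[OF XY] k has_proj_dim_iff[of "f X \<inter> f Y" "int n - 2"] by auto
    qed
    obtain X where "X \<in> ?G" using nonempty by blast
    then obtain A where A: "A \<in> S" using S_vertex by blast
    obtain X Y where XY: "X \<in> A" "Y \<in> A" "X \<noteq> Y" using S_two[OF A] by blast
    have XYG: "X \<in> ?G" "Y \<in> ?G" using XY S_sub A by auto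
    have aXY: "?adj X Y" using S_adj A XY by blast
    obtain B where B: "B \<in> T" "X \<in> B" "Y \<in> B" using T_edge[OF XYG aXY] by blast
    obtain Z W where ZW: "Z \<in> A" "W \<in> B" "Z \<noteq> W" "\<not> ?adj Z W" "?adj Z X" "?adj Z Y" "?adj W X" "?adj W Y"
      using diamond[OF A B(1), of X Y] XY B by blast
    have ZWG: "Z \<in> ?G" "W \<in> ?G" using ZW S_sub[OF A] T_sub[OF B(1)] by auto
    have ne: "X \<noteq> Z" "Y \<noteq> Z" "X \<noteq> W" "Y \<noteq> W"
      using ZW fadj XYG ZWG unfolding polar_grassmann_adj_def by blast+
    have m: "Suc (prk (f X \<inter> f Y)) = n" "Suc (prk (f X \<inter> f Z)) = n" "Suc (prk (f Y \<inter> f Z)) = n"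
      "Suc (prk (f X \<inter> f W)) = n" "Suc (prk (f Y \<inter> f W)) = n"
      using adj_iff XYG ZWG ne XY(3) aXY ZW(5-8) adj_sym by blast+
    have "Suc (prk (f Z \<inter> f W)) = n"
      by (rule dual_polar_no_diamond[OF _ _ _ _ _ _ _ _ m]) (use fs k XYG ZWG finj ZW(3) in auto)
    then show False using adj_iff ZWG ZW by blast
  qed
  \<comment> \<open>With \<open>k \<le> n - 2\<close> only the first disjunct of adjacency remains.
    The rank parameter is \<open>Suc k\<close> because \<open>prk\<close> exceeds the projective
    dimension by one.\<close>
  interpret polar_clique_embedding P L n ?G ?adj S T d f "Suc k"
  proof
    fix X Y assume XY: "X \<in> ?G" "Y \<in> ?G"
    have "Z \<in> polar_grassmannian P L (int k + 1) \<longleftrightarrow> singular Z \<and> prk Z = Suc (Suc k)" for Z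
      unfolding polar_grassmannian_iff by linarith
    moreover have "int k \<le> int n - 2" "int k \<noteq> int n - 1" using kn by linarith+
    ultimately show "?adj X Y \<longleftrightarrow> padj (Suc k) (f X) (f Y)"
      unfolding fadj[OF XY] polar_grassmann_adj_def padj_def Bex_def
      by (simp add: fin XY conj_assoc)
  qed (use frank finj in auto)
  have "Suc (Suc k) < n" using rank_bound kn by simp
  then have k3: "int k \<le> int n - 3" by simp
  have above: "\<exists>S \<in> polar_grassmannian P L (int k - 1). f ` ?G \<subseteq> elements_above P L (int k) S"
    if "singular K" "Suc (prk K) = Suc k" "\<forall>X\<in>?G. K \<subseteq> f X" for K
    using that fin by (intro bexI[of _ K]) (auto simp: polar_grassmannian_iff elements_above_def)
  have below: "\<exists>U. singular U \<and> f ` ?G \<subseteq> elements_below P L (int k) U"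
    if "singular U" "\<forall>X\<in>?G. f X \<subseteq> U" for U
    using that fin by (intro exI[of _ U]) (auto simp: elements_below_def)
  show ?thesis
  proof (cases "k = 0")
    case True
    have e: "singular {}" by (simp add: singular_iff point_subspace_def)
    have "has_proj_dim P L {} (- 1)"
      unfolding has_proj_dim_def independent_points_def
      using pspan_subspace[of "{}"] e by (auto simp: singular_iff)
    then have "prk {} = 0" using has_proj_dim_iff[OF e] by simp
    then show ?thesis using above[OF e] True k3 by simp
  next
    case False
    then show ?thesis using embedding_dichotomy above below k3 by (metis One_nat_def Suc_leI neq0_conv)
  qed
qed

end
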